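(* Let $G$ be the limit of the normalized numbers of nonzero states of $T_b$ (defined in the context). Then: (i) The function $G$ on $[0,1]$ is Riemann integrable. (ii) $\int_0^1G(x)\,dx=1/6$.
   Context: A two-dimensional elementary cellular automaton is a map $T:\{0,1\}^{\mathbb{Z}^2}\to\{0,1\}^{\mathbb{Z}^2}$ such that $(Tx)_{i,j}$ is given by a fixed local rule $f:\{0,1\}^5\to\{0,1\}$ applied to the center $C=x_{i,j}$ and its four von Neumann neighbors $U=x_{i,j+1}$, $D=x_{i,j-1}$, $L=x_{i-1,j}$, $R=x_{i+1,j}$. It is symmetrical if $f$ is invariant under left-right and top-bottom reflections and under rotations by multiples of $90^\circ$ of the four neighbors. Call two neighbors opposite if they are $\{U,D\}$ or $\{L,R\}$, and adjacent otherwise. $T_b$ denotes any symmetrical two-dimensional elementary cellular automaton whose local rule satisfies the following. If $C=0$: output $0$ if no neighbor is $1$; output $1$ if exactly one neighbor is $1$; output $0$ if exactly two neighbors are $1$ and they are adjacent; output $1$ if all four neighbors are $1$; the output is arbitrary if exactly two opposite neighbors, or exactly three neighbors, are $1$. If $C=1$: output $1$ if no neighbor is $1$; output $1$ if exactly one neighbor is $1$; output $0$ if exactly two neighbors are $1$ and they are adjacent; output $1$ if exactly two neighbors are $1$ and they are opposite; output $1$ if all four neighbors are $1$; the output is arbitrary if exactly three neighbors are $1$. (The arbitrary values, chosen compatibly with the symmetry, do not affect the orbit considered.) The single site seed $x_o\in\{0,1\}^{\mathbb{Z}^2}$ has $(x_o)_{0,0}=1$ and all other entries $0$. Define $num_b(0)=0$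 and, for $t\ge1$, $num_b(t)=\sum_{(i,j)\in\mathbb{Z}^2}(T_b^{t-1}x_o)_{i,j}$. Binary expansions: $x\in[0,1]$ is written $x=\sum_{i=0}^{\infty}x_i2^{-i}$, $x_i\in\{0,1\}$, using the finite expansion whenever there are two (so $x_0=1$ only for $x=1$). For $k>0$ and $x=t/2^k$ with $t$ an integer, $0\le t\le2^k$, put $G_k(x)=num_b(t)/num_b(2^k)$. For $x\in[0,1]$ with truncations $x|_k=\sum_{i=0}^{k}x_i2^{-i}$, $G(x)=\lim_{k\to\infty}G_k(x|_k)$ (the limit exists). *)

theory Defs
  imports "HOL-Analysis.Analysis"
begin

text \<open>The states 0 and 1 are represented by \<^term>\<open>False\<close> and \<^term>\<open>True\<close>. A local rule
  takes its arguments in the order center, up, down, left, right.\<close>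

type_synonym config = "int \<times> int \<Rightarrow> bool"
type_synonym local_rule = "bool \<Rightarrow> bool \<Rightarrow> bool \<Rightarrow> bool \<Rightarrow> bool \<Rightarrow> bool"

definition ca_map :: "local_rule \<Rightarrow> config \<Rightarrow> config" where
  "ca_map f x = (\<lambda>(i, j). f (x (i, j)) (x (i, j + 1)) (x (i, j - 1)) (x (i - 1, j)) (x (i + 1, j)))"

definition symmetrical :: "local_rule \<Rightarrow> bool" where
  "symmetrical f \<longleftrightarrow>
     (\<forall>c u d l r. f c u d l r = f c u d r l) \<and>
     (\<forall>c u d l r. f c u d l r = f c d u l r) \<and>
     (\<forall>c u d l r. f c u d l r = f c r l u d)"

definition nbr_count :: "bool \<Rightarrow> bool \<Rightarrow> bool \<Rightarrow> bool \<Rightarrow> nat" where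
  "nbr_count u d l r = of_bool u + of_bool d + of_bool l + of_bool r"

definition two_opposite :: "bool \<Rightarrow> bool \<Rightarrow> bool \<Rightarrow> bool \<Rightarrow> bool" where
  "two_opposite u d l r \<longleftrightarrow> (u \<and> d \<and> \<not> l \<and> \<not> r) \<or> (\<not> u \<and> \<not> d \<and> l \<and> r)"

definition two_adjacent :: "bool \<Rightarrow> bool \<Rightarrow> bool \<Rightarrow> bool \<Rightarrow> bool" where
  "two_adjacent u d l r \<longleftrightarrow> nbr_count u d l r = 2 \<and> \<not> two_opposite u d l r"

text \<open>The following cases are left unconstrained: center 0 with two opposite neighbors equal to 1,
  and three neighbors equal to 1 (for either center).\<close>

definition Tb_rule :: "local_rule \<Rightarrow> bool" where
  "Tb_rule f \<longleftrightarrow> symmetrical f \<and>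
     (\<forall>u d l r.
        (nbr_count u d l r = 0 \<longrightarrow> \<not> f False u d l r) \<and>
        (nbr_count u d l r = 1 \<longrightarrow> f False u d l r) \<and>
        (two_adjacent u d l r \<longrightarrow> \<not> f False u d l r) \<and>
        (nbr_count u d l r = 4 \<longrightarrow> f False u d l r) \<and>
        (nbr_count u d l r = 0 \<longrightarrow> f True u d l r) \<and>
        (nbr_count u d l r = 1 \<longrightarrow> f True u d l r) \<and>
        (two_adjacent u d l r \<longrightarrow> \<not> f True u d l r) \<and>
        (two_opposite u d l r \<longrightarrow> f True u d l r) \<and>
        (nbr_count u d l r = 4 \<longrightarrow> f True u d l r))"

lemma Tb_rule_exists: "\<exists>f. Tb_rule f"
proof
  show "Tb_rule (\<lambda>c u d l r. nbr_count u d l r = 1 \<or> nbr_count u d l r = 4 \<or>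
          (c \<and> (nbr_count u d l r = 0 \<or> two_opposite u d l r)))"
    unfolding Tb_rule_def symmetrical_def
    by (auto simp: nbr_count_def two_opposite_def two_adjacent_def)
qed

definition seed :: config where
  "seed p \<longleftrightarrow> p = (0, 0)"

definition num_b :: "local_rule \<Rightarrow> nat \<Rightarrow> real" where
  "num_b f t = (if t = 0 then 0
     else \<Sum>\<^sub>\<infinity>p\<in>UNIV. of_bool (((ca_map f ^^ (t - 1)) seed) p))"

lemma finite_support_orbit:
  assumes "Tb_rule f"
  shows "finite {p. ((ca_map f ^^ n) seed) p}"
proof (induction n)
  case 0
  show ?case by (simp add: seed_def)
next
  case (Suc n)
  let ?x = "(ca_map f ^^ n) seed"
  let ?S = "{p. ?x p}"
  have f0: "\<not> f False False False False False"
    proof -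
    have "nbr_count False False False False = 0" by (simp add: nbr_count_def)
    with assms show ?thesis unfolding Tb_rule_def by blast
  qed
  have "{p. ca_map f ?x p} \<subseteq>
      ?S \<union> (\<lambda>(i, j). (i, j - 1)) ` ?S \<union> (\<lambda>(i, j). (i, j + 1)) ` ?S
         \<union> (\<lambda>(i, j). (i + 1, j)) ` ?S \<union> (\<lambda>(i, j). (i - 1, j)) ` ?S"
  proof (rule subsetI, rule ccontr)
    fix p
    assume p: "p \<in> {p. ca_map f ?x p}" and
      np: "p \<notin> ?S \<union> (\<lambda>(i, j). (i, j - 1)) ` ?S \<union> (\<lambda>(i, j). (i, j + 1)) ` ?S
         \<union> (\<lambda>(i, j). (i + 1, j)) ` ?S \<union> (\<lambda>(i, j). (i - 1, j)) ` ?S"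
    obtain i j where ij: "p = (i, j)" by (cases p)
    have "\<not> ?x (i, j)" "\<not> ?x (i, j + 1)" "\<not> ?x (i, j - 1)" "\<not> ?x (i - 1, j)" "\<not> ?x (i + 1, j)"
      using np unfolding ij by (force simp: image_iff)+
    with p f0 show False by (simp add: ij ca_map_def)
  qed
  moreover have "finite \<dots>" using Suc.IH by simp
  ultimately show ?case by (simp add: finite_subset)
qed

lemma num_b_eq_card:
  assumes "Tb_rule f" "t \<ge> 1"
  shows "num_b f t = real (card {p. ((ca_map f ^^ (t - 1)) seed) p})"
proof -
  let ?x = "(ca_map f ^^ (t - 1)) seed"
  have "(\<Sum>\<^sub>\<infinity>p\<in>UNIV. of_bool (?x p)) = (\<Sum>\<^sub>\<infinity>p\<in>{p. ?x p}. (1::real))"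
    by (rule infsum_cong_neutral) auto
  also have "\<dots> = real (card {p. ?x p})"
    using finite_support_orbit[OF assms(1)] by simp
  finally show ?thesis using assms(2) by (simp add: num_b_def)
qed

text \<open>Digits of the binary expansion of \<open>x \<in> [0,1]\<close>, the digit of index \<open>i\<close> having weight
  \<open>1/2^i\<close>. The lemmas \<open>bin_digit_cases\<close>, \<open>bin_digit_sums\<close> and \<open>bin_digit_dyadic\<close> below say that
  this is an expansion of \<open>x\<close>, and the finite one whenever there are two.\<close>

definition bin_digit :: "real \<Rightarrow> nat \<Rightarrow> int" where
  "bin_digit x i = \<lfloor>2 ^ i * x\<rfloor> mod 2"

definition bin_trunc :: "real \<Rightarrow> nat \<Rightarrow> real" where
  "bin_trunc x k = (\<Sum>i\<le>k. of_int (bin_digit x i) / 2 ^ i)"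

lemma bin_digit_cases: "bin_digit x i = 0 \<or> bin_digit x i = 1"
  unfolding bin_digit_def by presburger

lemma floor_double: "\<lfloor>2 * y\<rfloor> = 2 * \<lfloor>y\<rfloor> + \<lfloor>2 * y\<rfloor> mod 2" for y :: real
proof -
  have "2 * \<lfloor>y\<rfloor> \<le> \<lfloor>2 * y\<rfloor>" "\<lfloor>2 * y\<rfloor> \<le> 2 * \<lfloor>y\<rfloor> + 1"
    by linarith+
  then show ?thesis by presburger
qed

lemma bin_trunc_eq_floor:
  assumes "0 \<le> x" "x \<le> 1"
  shows "bin_trunc x k = of_int \<lfloor>2 ^ k * x\<rfloor> / 2 ^ k"
proof (induction k)
  case 0
  have "\<lfloor>x\<rfloor> = 0 \<or> \<lfloor>x\<rfloor> = 1" using assms by linarith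
  then show ?case by (auto simp: bin_trunc_def bin_digit_def)
next
  case (Suc k)
  have "\<lfloor>2 ^ Suc k * x\<rfloor> = 2 * \<lfloor>2 ^ k * x\<rfloor> + bin_digit x (Suc k)"
    using floor_double[of "2 ^ k * x"] by (simp add: bin_digit_def mult.assoc)
  then have "real_of_int \<lfloor>2 ^ Suc k * x\<rfloor> / 2 ^ Suc k =
      of_int \<lfloor>2 ^ k * x\<rfloor> / 2 ^ k + of_int (bin_digit x (Suc k)) / 2 ^ Suc k"
    by (simp add: field_simps)
  with Suc.IH show ?case by (simp add: bin_trunc_def)
qed

lemma bin_digit_sums:
  assumes "0 \<le> x" "x \<le> 1"
  shows "(\<lambda>i. of_int (bin_digit x i) / 2 ^ i) sums x"
proof -
  have lim0: "(\<lambda>k. (1 / 2) ^ k) \<longlonglongrightarrow> (0::real)"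
    by (rule LIMSEQ_power_zero) simp
  have "norm (bin_trunc x k - x) \<le> (1 / 2) ^ k" for k
  proof -
    have "bin_trunc x k - x = (of_int \<lfloor>2 ^ k * x\<rfloor> - 2 ^ k * x) / 2 ^ k"
      using assms by (simp add: bin_trunc_eq_floor diff_divide_distrib)
    moreover have "\<bar>of_int \<lfloor>2 ^ k * x\<rfloor> - 2 ^ k * x\<bar> \<le> 1" by linarith
    ultimately show ?thesis by (simp add: abs_divide power_one_over divide_right_mono)
  qed
  then have "(\<lambda>k. bin_trunc x k - x) \<longlonglongrightarrow> 0"
    by (intro Lim_null_comparison[OF _ lim0] always_eventually) blast
  then have "bin_trunc x \<longlonglongrightarrow> x" by (simp add: LIM_zero_iff)
  then show ?thesis by (simp add: sums_def_le bin_trunc_def[abs_def])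
qed

lemma bin_digit_dyadic:
  assumes "x = of_int t / 2 ^ k" "i > k"
  shows "bin_digit x i = 0"
proof -
  obtain m where m: "i = k + Suc m" using less_imp_Suc_add[OF assms(2)] by auto
  have "2 ^ i * x = of_int (2 * (2 ^ m * t))"
    using assms(1) m by (simp add: power_add)
  then have "\<lfloor>2 ^ i * x\<rfloor> = 2 * (2 ^ m * t)" by (simp only: floor_of_int)
  then show ?thesis by (simp add: bin_digit_def)
qed

text \<open>Only used for \<open>x = t / 2 ^ k\<close> with \<open>t\<close> a natural number; the argument of \<^const>\<open>num_b\<close> in
  the numerator is then exactly \<open>t\<close>.\<close>

definition G_approx :: "local_rule \<Rightarrow> nat \<Rightarrow> real \<Rightarrow> real" where
  "G_approx f k x = num_b f (nat \<lfloor>2 ^ k * x\<rfloor>) / num_b f (2 ^ k)"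

lemma G_approx_dyadic: "G_approx f k (real t / 2 ^ k) = num_b f t / num_b f (2 ^ k)"
  by (simp add: G_approx_def)

definition G_lim :: "local_rule \<Rightarrow> real \<Rightarrow> real" where
  "G_lim f x = lim (\<lambda>k. G_approx f k (bin_trunc x k))"

text \<open>The integral of the library is the gauge integral, so Riemann integrability is defined here by
  Riemann sums over tagged divisions of small mesh; for an interval \<open>K\<close> of reals,
  \<^term>\<open>measure lborel K\<close> is its length. By the lemma below the values of the two integrals agree.\<close>

definition has_riemann_integral :: "(real \<Rightarrow> real) \<Rightarrow> real \<Rightarrow> real \<Rightarrow> real \<Rightarrow> bool" where
  "has_riemann_integral g I a b \<longleftrightarrow>
     (\<forall>e>0. \<exists>d>0. \<forall>p. p tagged_division_of {a..b} \<and> (\<forall>(x, K)\<in>p. measure lborel K < d) \<longrightarrow>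
        \<bar>(\<Sum>(x, K)\<in>p. measure lborel K * g x) - I\<bar> < e)"

definition riemann_integrable :: "(real \<Rightarrow> real) \<Rightarrow> real \<Rightarrow> real \<Rightarrow> bool" where
  "riemann_integrable g a b \<longleftrightarrow> (\<exists>I. has_riemann_integral g I a b)"

lemma has_riemann_integral_imp_has_integral:
  assumes "has_riemann_integral g I a b"
  shows "(g has_integral I) {a..b}"
  unfolding box_real[symmetric] has_integral
proof (intro allI impI)
  fix e :: real
  assume "e > 0"
  with assms obtain d where "d > 0" and
    d: "\<And>p. \<lbrakk>p tagged_division_of {a..b}; \<forall>(x, K)\<in>p. measure lborel K < d\<rbrakk>
          \<Longrightarrow> \<bar>(\<Sum>(x, K)\<in>p. measure lborel K * g x) - I\<bar> < e"
    unfolding has_riemann_integral_def by metis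
  let ?\<gamma> = "\<lambda>x::real. ball x (d / 2)"
  show "\<exists>\<gamma>. gauge \<gamma> \<and> (\<forall>p. p tagged_division_of cbox a b \<and> \<gamma> fine p \<longrightarrow>
          norm ((\<Sum>(x, K)\<in>p. measure lborel K *\<^sub>R g x) - I) < e)"
  proof (intro exI[of _ ?\<gamma>] conjI allI impI)
    show "gauge ?\<gamma>" using \<open>d > 0\<close> by (simp add: gauge_ball)
  next
    fix p
    assume p: "p tagged_division_of cbox a b \<and> ?\<gamma> fine p"
    have "measure lborel K < d" if xK: "(x, K) \<in> p" for x K
    proof -
      obtain u v where K: "K = {u..v}" using tagged_division_ofD(4)[of p "cbox a b" x K] p xK by auto
      have sub: "K \<subseteq> ball x (d / 2)" using p xK by (auto simp: fine_def)
      have "x \<in> K" using tagged_division_ofD(2)[of p "cbox a b" x K] p xK by auto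
      then have uv: "u \<le> v" by (simp add: K)
      then have "u \<in> ball x (d / 2)" "v \<in> ball x (d / 2)" using sub by (auto simp: K)
      then have "v - u < d" unfolding mem_ball dist_real_def by linarith
      then show ?thesis using uv by (simp add: K)
    qed
    then show "norm ((\<Sum>(x, K)\<in>p. measure lborel K *\<^sub>R g x) - I) < e"
      using d[of p] p by auto
  qed
qed

end

theory Submission
  imports Defs
begin

text \<open>Let \<open>m\<close> be a power of two, \<open>m > 1\<close>. At time \<open>m - 1\<close> the orbit fills the cells of odd coordinate sum of
  the diamond \<open>|i| + |j| < m\<close> and avoids those with two odd coordinates, so that at time \<open>m\<close> it is
  that whole diamond together with one cell beyond each of its four corners. From then on the diamond
  shrinks by one layer per step while a copy of the orbit of the seed grows out of each of the four
  cells without disturbance, until the diamond has become a single cell at time \<open>2 m - 1\<close>.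
  Counting cells gives \<open>N(m + s) = 4 N(s) + 2 (m - s) (m - s + 1) + 1\<close> for \<open>0 < s \<le> m\<close>. In the limit
  \<open>G(x) = G(2x) / 4\<close> for \<open>x \<le> 1/2\<close> and \<open>G(x) = G(2x - 1) + 3/2 (1 - x)\<^sup>2\<close> for \<open>x > 1/2\<close>. The first
  equation contracts oscillations by the factor 4 and the second preserves them, so \<open>G\<close> is continuous
  at every non-dyadic point and hence Riemann integrable, and the integral \<open>I\<close> of \<open>G\<close> satisfies
  \<open>I = I/8 + I/2 + 1/16\<close>.\<close>

subsection \<open>The orbit of the single site seed\<close>

abbreviation orbit :: "local_rule \<Rightarrow> nat \<Rightarrow> config" where
  "orbit f n \<equiv> (ca_map f ^^ n) seed"

lemma orbit_Suc:
  "orbit f (Suc n) (i, j) = f (orbit f n (i, j)) (orbit f n (i, j + 1)) (orbit f n (i, j - 1))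
     (orbit f n (i - 1, j)) (orbit f n (i + 1, j))"
  by (simp add: ca_map_def)

text \<open>Steps of the orbit are unfolded only on request, cell by cell, through
  \<open>orbit_Suc\<close>.\<close>

declare funpow.simps [simp del]

text \<open>Reflection and swap generate the symmetry group of the square, so the case analyses
  below need only treat cells with \<open>0 <= j <= i\<close>.\<close>

lemma orbit_symmetric:
  assumes "symmetrical f"
  shows "orbit f n (- i, j) = orbit f n (i, j)" "orbit f n (j, i) = orbit f n (i, j)"
proof -
  \<comment> \<open>\<open>t\<close> is the reflection in the diagonal: the rotation in
    \<open>symmetrical\<close> followed by a left-right reflection.\<close>
  have lr: "f c u d l r = f c u d r l" and t: "f c u d l r = f c r l d u" for c u d l r
    using assms unfolding symmetrical_def by metis+
  have "orbit f n (- i, j) = orbit f n (i, j) \<and> orbit f n (j, i) = orbit f n (i, j)" for i j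
  proof (induction n arbitrary: i j)
    case (Suc n)
    have IH: "orbit f n (- i, j) = orbit f n (i, j)"
      and IH': "orbit f n (j, i) = orbit f n (i, j)" for i j using Suc.IH by blast+
    have "orbit f (Suc n) (- i, j) = orbit f (Suc n) (i, j)"
      using IH[of "i + 1" j] IH[of "i - 1" j] IH lr by (simp add: orbit_Suc)
    moreover have "orbit f (Suc n) (j, i) = orbit f (Suc n) (i, j)"
      using IH'[of j i] IH'[of j "i + 1"] IH'[of j "i - 1"] IH'[of "j + 1" i] IH'[of "j - 1" i] t
      by (simp add: orbit_Suc)
    ultimately show ?case ..
  qed (auto simp: seed_def)
  then show "orbit f n (- i, j) = orbit f n (i, j)" "orbit f n (j, i) = orbit f n (i, j)"
    by blast+
qed

text \<open>The part of the rule table from which the whole orbit is computed. It has no entry for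
  center 0 with two opposite neighbors or for three neighbors, so the result holds for every choice
  of the arbitrary values.\<close>

lemma Tb_rule_values:
  assumes "Tb_rule f"
  shows "\<not> f False False False False False" "f True False False False False"
    "f c True False False False" "f c False True False False"
    "f c False False True False" "f c False False False True"
    "\<not> f c True False True False" "\<not> f c True False False True"
    "\<not> f c False True True False" "\<not> f c False True False True"
    "f c True True True True" "f True True True False False" "f True False False True True"
proof -
  note defs = nbr_count_def two_adjacent_def two_opposite_def
  have *: "nbr_count u d l r = 0 \<Longrightarrow> \<not> f False u d l r" "nbr_count u d l r = 0 \<Longrightarrow> f True u d l r"
    "nbr_count u d l r = 1 \<Longrightarrow> f c u d l r" "two_adjacent u d l r \<Longrightarrow> \<not> f c u d l r"
    "nbr_count u d l r = 4 \<Longrightarrow> f c u d l r" "two_opposite u d l r \<Longrightarrow> f True u d l r" for c u d l r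
    using assms[unfolded Tb_rule_def, THEN conjunct2, THEN spec, THEN spec, THEN spec, THEN spec,
      of u d l r] by (cases c; simp)+
  show "\<not> f False False False False False" "f True False False False False"
    "f c True False False False" "f c False True False False"
    "f c False False True False" "f c False False False True"
    "\<not> f c True False True False" "\<not> f c True False False True"
    "\<not> f c False True True False" "\<not> f c False True False True"
    "f c True True True True" "f True True True False False" "f True False False True True"
    by (rule *; simp add: defs)+
qed

section \<open>Light cone and tips of the orbit\<close>

lemma orbit_support:
  assumes "Tb_rule f" "orbit f n (i, j)"
  shows "\<bar>i\<bar> + \<bar>j\<bar> \<le> int n"
  using assms(2)
proof (induction n arbitrary: i j)
  case 0
  then show ?case by (simp add: seed_def)
next
  case (Suc n)
  show ?case
  proof (rule ccontr)
    assume "\<not> ?thesis"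
    then have "\<not> orbit f n (a, b)" if "\<bar>a - i\<bar> + \<bar>b - j\<bar> \<le> 1" for a b
      using that Suc.IH[of a b] by linarith
    with Suc.prems show False
      by (simp add: orbit_Suc Tb_rule_values(1)[OF assms(1)])
  qed
qed

lemma orbit_outside:
  assumes "Tb_rule f" "\<bar>i\<bar> + \<bar>j\<bar> > int n"
  shows "\<not> orbit f n (i, j)"
  using orbit_support[OF assms(1), of n i j] assms(2) by linarith

text \<open>The cell just beyond the light cone has a single neighbor inside it, the previous
  tip.\<close>

lemma orbit_tip:
  assumes "Tb_rule f"
  shows "orbit f n (int n, 0)"
proof (induction n)
  case 0
  then show ?case by (simp add: seed_def)
next
  case (Suc n)
  have "\<not> orbit f n (int n + 1, 0)" "\<not> orbit f n (int n + 1, 1)" "\<not> orbit f n (int n + 1, - 1)"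
     "\<not> orbit f n (int n + 2, 0)"
    by (rule orbit_outside[OF assms]; simp)+
  with Suc show ?case
    using Tb_rule_values(5)[OF assms] orbit_Suc[of n f "int n + 1" 0]
    by (simp add: add.commute[of _ "int n"])
qed

text \<open>The old tip has center 1, and only its left neighbor can be 1; either value of that
  neighbor gives output 1. The two tip lemmas settle the cells where a growing copy touches the
  diamond.\<close>

lemma orbit_previous_tip:
  assumes "Tb_rule f"
  shows "orbit f (Suc n) (int n, 0)"
proof -
  have "\<not> orbit f n (int n, 1)" "\<not> orbit f n (int n, - 1)"
     "\<not> orbit f n (int n + 1, 0)"
    by (rule orbit_outside[OF assms]; simp)+
  with orbit_tip[OF assms, of n] show ?thesis
    using Tb_rule_values(2,5)[OF assms] orbit_Suc[of n f "int n" 0]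
    by (cases "orbit f n (int n - 1, 0)") simp_all
qed

section \<open>The diamond eroding between four growing copies of the orbit\<close>

definition spread :: "local_rule \<Rightarrow> nat \<Rightarrow> nat \<Rightarrow> config" where
  "spread f m u = (\<lambda>(i, j). \<bar>i\<bar> + \<bar>j\<bar> < int m - int u
     \<or> orbit f u (i - int m, j) \<or> orbit f u (i + int m, j)
     \<or> orbit f u (i, j - int m) \<or> orbit f u (i, j + int m))"

text \<open>The octant \<open>0 <= j <= i\<close> is a fundamental domain: each cell is moved to the
  pair of the maximum and the minimum of its absolute coordinates.\<close>

lemma symmetric_config_eqI:
  fixes x y :: config
  assumes "\<And>i j. 0 \<le> j \<Longrightarrow> j \<le> i \<Longrightarrow> x (i, j) = y (i, j)"
    and x: "\<And>i j. x (- i, j) = x (i, j)" "\<And>i j. x (j, i) = x (i, j)"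
    and y: "\<And>i j. y (- i, j) = y (i, j)" "\<And>i j. y (j, i) = y (i, j)"
  shows "x = y"
proof -
  have a: "z (i, j) = z (max \<bar>i\<bar> \<bar>j\<bar>, min \<bar>i\<bar> \<bar>j\<bar>)"
    if z: "\<And>i j. z (- i, j) = z (i, j)" "\<And>i j. z (j, i) = z (i, j)" for z :: config and i j
  proof -
    have n: "z (i, - j) = z (i, j)" for i j using z by metis
    have "z (i, j) = z (\<bar>i\<bar>, \<bar>j\<bar>)" by (simp add: abs_if z(1) n)
    then show ?thesis using z(2) by (simp add: max_def min_def)
  qed
  have "x (i, j) = y (i, j)" for i j
    unfolding a[OF x, of i j] a[OF y, of i j] by (rule assms(1)) auto
  then show ?thesis by auto
qed

lemma spread_symmetric:
  assumes "symmetrical f"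
  shows "spread f m u (- i, j) = spread f m u (i, j)" "spread f m u (j, i) = spread f m u (i, j)"
proof -
  have "orbit f u (- i - int m, j) = orbit f u (i + int m, j)" 
    "orbit f u (- i + int m, j) = orbit f u (i - int m, j)"
    using orbit_symmetric(1)[OF assms, of u "i + int m" j]
      orbit_symmetric(1)[OF assms, of u "i - int m" j] by simp_all
  then show "spread f m u (- i, j) = spread f m u (i, j)"
    using orbit_symmetric(1)[OF assms] unfolding spread_def by auto
  show "spread f m u (j, i) = spread f m u (i, j)"
    using orbit_symmetric(2)[OF assms] unfolding spread_def by (auto simp: add.commute)
qed

text \<open>In the octant only the diamond and the eastern copy matter; \<open>Suc u < m\<close>
  keeps the northern copy away even from the neighbors of a cell. Deep inside the diamond all
  neighbors are 1. Away from the axis its outermost layer and the layer beyond see two adjacent 1s,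
  so the first dies and the second stays empty. The copy evolves as if alone, also where it meets
  the diamond.\<close>

lemma ca_map_spread:
  assumes f: "Tb_rule f" and u: "Suc u < m"
  shows "ca_map f (spread f m u) = spread f m (Suc u)"
proof (rule symmetric_config_eqI)
  have sym: "symmetrical f" using f by (simp add: Tb_rule_def)
  have lr: "f c u d l r = f c u d r l" and t: "f c u d l r = f c r l d u" for c u d l r
    using sym unfolding symmetrical_def by metis+
  let ?y = "spread f m u"
  note ysym = spread_symmetric[OF sym, of m u]
  show "spread f m (Suc u) (- i, j) = spread f m (Suc u) (i, j)"
    "spread f m (Suc u) (j, i) = spread f m (Suc u) (i, j)" for i j
    by (rule spread_symmetric[OF sym])+
  show "ca_map f ?y (- i, j) = ca_map f ?y (i, j)" for i j
    using ysym(1)[of i] ysym(1)[of "i + 1" j] ysym(1)[of "i - 1" j] lr by (simp add: ca_map_def)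
  show "ca_map f ?y (j, i) = ca_map f ?y (i, j)" for i j
    using ysym(2)[of j i] ysym(2)[of j "i + 1"] ysym(2)[of j "i - 1"] ysym(2)[of "j + 1" i]
      ysym(2)[of "j - 1" i] t by (simp add: ca_map_def)
  fix i j :: int
  assume ij: "0 \<le> j" "j \<le> i"
  \<comment> \<open>The radius of the diamond. The western tip of the eastern copy lies on the axis
    at \<open>?R + 1\<close>, right next to it.\<close>
  let ?R = "int m - int u - 1"
  note far = orbit_outside[OF f]
  have yD: "?y (a, b)" if "\<bar>a\<bar> + \<bar>b\<bar> \<le> ?R" for a b
    using that by (simp add: spread_def)
  have yE: "?y (a, b) = orbit f u (a - int m, b)" if "\<bar>a\<bar> + \<bar>b\<bar> > ?R" 
      "\<bar>a + int m\<bar> + \<bar>b\<bar> > int u" "\<bar>a\<bar> + \<bar>b + int m\<bar> > int u" "\<bar>a\<bar> + \<bar>b - int m\<bar> > int u" for a b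
    using that far by (auto simp: spread_def)
  consider (inside) "i + j < ?R" | (east) "i + j \<ge> ?R" "\<bar>i - int m\<bar> + j \<le> int u + 1"
    | (outside) "i + j \<ge> ?R" "\<bar>i - int m\<bar> + j > int u + 1" by linarith
  then show "ca_map f ?y (i, j) = spread f m (Suc u) (i, j)"
  proof cases
    case inside
    then have "?y (i, j)" "?y (i, j + 1)" "?y (i, j - 1)" "?y (i - 1, j)" "?y (i + 1, j)"
      using ij by (intro yD; linarith)+
    then show ?thesis using inside ij Tb_rule_values(11)[OF f]
      by (simp add: ca_map_def spread_def)
  next
    case outside
    have y: "?y (a, b) = (\<bar>a\<bar> + \<bar>b\<bar> \<le> ?R)" if "\<bar>a - i\<bar> + \<bar>b - j\<bar> \<le> 1" for a b
    proof (cases "\<bar>a\<bar> + \<bar>b\<bar> \<le> ?R")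
      case False
      have "\<bar>a + int m\<bar> + \<bar>b\<bar> > int u" "\<bar>a\<bar> + \<bar>b + int m\<bar> > int u" "\<bar>a\<bar> + \<bar>b - int m\<bar> > int u"
         "\<bar>a - int m\<bar> + \<bar>b\<bar> > int u"
        using that outside ij u by linarith+
      then show ?thesis using False yE far by simp
    qed (simp add: yD)
    have "\<bar>i + int m\<bar> + \<bar>j\<bar> > int (Suc u)" "\<bar>i\<bar> + \<bar>j + int m\<bar> > int (Suc u)" 
      "\<bar>i\<bar> + \<bar>j - int m\<bar> > int (Suc u)" "\<bar>i - int m\<bar> + \<bar>j\<bar> > int (Suc u)"
      using outside ij u by linarith+
    then have R: "\<not> spread f m (Suc u) (i, j)" 
      using outside far ij by (simp add: spread_def)
    \<comment> \<open>The axis cells at \<open>?R\<close> and \<open>?R + 1\<close> belong to the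
      case \<open>east\<close>.\<close>
    have j: "j \<noteq> 0" if "i + j \<le> ?R + 1" using outside that by auto
    \<comment> \<open>On the first two layers exactly the down and left neighbors are 1, whatever
      the center is.\<close>
    have "i + j = ?R \<or> i + j = ?R + 1 \<or> i + j \<ge> ?R + 2" using outside by linarith
    then show ?thesis
    proof (elim disjE)
      assume "i + j = ?R"
      then have "?y (i, j)" "\<not> ?y (i, j + 1)" "?y (i, j - 1)" "?y (i - 1, j)" "\<not> ?y (i + 1, j)"
        using ij j by (simp_all add: y)
      then show ?thesis using R Tb_rule_values(9)[OF f] by (simp add: ca_map_def)
    next
      assume "i + j = ?R + 1"
      then have "\<not> ?y (i, j)" "\<not> ?y (i, j + 1)" "?y (i, j - 1)" "?y (i - 1, j)" "\<not> ?y (i + 1, j)"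
        using ij j by (simp_all add: y)
      then show ?thesis using R Tb_rule_values(9)[OF f] by (simp add: ca_map_def)
    next
      assume "i + j \<ge> ?R + 2"
      then have "\<not> ?y (i, j)" "\<not> ?y (i, j + 1)" "\<not> ?y (i, j - 1)" "\<not> ?y (i - 1, j)" "\<not> ?y (i + 1, j)"
        using ij by (simp_all add: y)
      then show ?thesis using R Tb_rule_values(1)[OF f] by (simp add: ca_map_def)
    qed
  next
    case east
    have y: "?y (a, b) = orbit f u (a - int m, b)" if "\<bar>a - i\<bar> + \<bar>b - j\<bar> \<le> 1" "\<bar>a\<bar> + \<bar>b\<bar> > ?R" for a b
      using that east ij u by (intro yE) linarith+
    have neg: "orbit f v (- int v, 0)" "orbit f (Suc v) (- int v, 0)" for v
      using orbit_tip[OF f] orbit_previous_tip[OF f] orbit_symmetric(1)[OF sym] by metis+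
    show ?thesis
    proof (cases "i + j \<le> ?R + 1")
      case True
      then have j: "j = 0" using east ij by linarith
      have "i = ?R \<or> i = ?R + 1" using True east j by linarith
      then show ?thesis
      proof
        \<comment> \<open>The corner of the diamond lies between the diamond and the tip of the
          copy: two opposite neighbors keep it 1, and it becomes the next tip of the copy.\<close>
        assume i: "i = ?R"
        have "?y (i, j)" "?y (i - 1, j)" 
          using i j ij u by (intro yD; linarith)+
        moreover have "?y (i + 1, j)"
          using i j ij u neg(1)[of u] y[of "i + 1" j] by simp
        moreover have "\<not> ?y (i, j + 1)" "\<not> ?y (i, j - 1)"
          using i j ij u y[of i "j + 1"] y[of i "j - 1"] by (simp_all add: far)
        moreover have "spread f m (Suc u) (i, j)"
        proof -
          have "i - int m = - int (Suc u)" using i by simp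
          then show ?thesis using neg(1)[of "Suc u"] j unfolding spread_def by auto
        qed
        ultimately show ?thesis using Tb_rule_values(13)[OF f] by (simp add: ca_map_def)
      next
        \<comment> \<open>The left neighbor is 1 here, while it would be 0 for the copy alone. The
          output is 1 in both situations, the latter by \<open>orbit_previous_tip\<close>.\<close>
        assume i: "i = ?R + 1"
        have "?y (i - 1, j)" 
          using i j ij u by (intro yD; linarith)+
        moreover have "?y (i, j)"
          using i j ij u neg(1)[of u] y[of i j] by simp
        moreover have "\<not> ?y (i, j + 1)" "\<not> ?y (i, j - 1)"
          using i j ij u y[of i "j + 1"] y[of i "j - 1"] by (simp_all add: far)
        moreover have "spread f m (Suc u) (i, j)"
          using neg(2)[of u] i j by (simp add: spread_def)
        ultimately show ?thesis using Tb_rule_values(5,13)[OF f] 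
          by (cases "?y (i + 1, j)") (simp_all add: ca_map_def)
      qed
    next
      case False
      have "?y (i, j) = orbit f u (i - int m, j)" "?y (i, j + 1) = orbit f u (i - int m, j + 1)"
        "?y (i, j - 1) = orbit f u (i - int m, j - 1)"
        "?y (i - 1, j) = orbit f u (i - int m - 1, j)"
        "?y (i + 1, j) = orbit f u (i - int m + 1, j)"
        using False ij y[of i j] y[of i "j + 1"] y[of i "j - 1"] y[of "i - 1" j] y[of "i + 1" j]
        by (simp_all add: algebra_simps)
      then have "ca_map f ?y (i, j) = orbit f (Suc u) (i - int m, j)"
        by (simp add: ca_map_def orbit_Suc)
      moreover have "\<bar>i + int m\<bar> + \<bar>j\<bar> > int (Suc u)" "\<bar>i\<bar> + \<bar>j + int m\<bar> > int (Suc u)" 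
        "\<bar>i\<bar> + \<bar>j - int m\<bar> > int (Suc u)"
        using east ij u by linarith+
      then have "spread f m (Suc u) (i, j) = orbit f (Suc u) (i - int m, j)"
        using far False ij by (simp add: spread_def)
      ultimately show ?thesis by simp
    qed
  qed
qed

lemma orbit_spread:
  assumes f: "Tb_rule f" and m: "orbit f m = spread f m 0" and u: "u < m"
  shows "orbit f (m + u) = spread f m u"
  using u
proof (induction u)
  case (Suc u)
  have "orbit f (m + Suc u) = ca_map f (orbit f (m + u))"
    by (simp add: funpow.simps)
  with Suc show ?case by (simp add: ca_map_spread[OF f])
qed (simp add: m)

text \<open>Parity alone describes enough of the orbit at time \<open>m - 1\<close>, for \<open>m\<close> a power of two, to
  determine it at time \<open>m\<close>; the cells with two even coordinates may have any values.\<close>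

definition odd_filled :: "nat \<Rightarrow> config \<Rightarrow> bool" where
  "odd_filled m x \<longleftrightarrow>
     (\<forall>i j. odd (i + j) \<longrightarrow> \<bar>i\<bar> + \<bar>j\<bar> < int m \<longrightarrow> x (i, j)) \<and> (\<forall>i j. odd i \<longrightarrow> odd j \<longrightarrow> \<not> x (i, j))"

text \<open>Cells of even sum inside the diamond see four 1s. A cell of odd sum is 1, and its
  neighbors along one axis have two odd coordinates, hence are 0; the other two are opposite, so the
  cell survives whatever they are. On the layer \<open>i + j = m\<close> two adjacent inner
  neighbors give 0, except at the corner, which has only one.\<close>

lemma ca_map_odd_filled:
  assumes f: "Tb_rule f" and m: "even m" "m > 0" and x: "odd_filled m (orbit f n)" "m = Suc n"
  shows "orbit f m = spread f m 0"
proof (rule symmetric_config_eqI)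
  have sym: "symmetrical f" using f by (simp add: Tb_rule_def)
  show "spread f m 0 (- i, j) = spread f m 0 (i, j)" "spread f m 0 (j, i) = spread f m 0 (i, j)"
    "orbit f m (- i, j) = orbit f m (i, j)" "orbit f m (j, i) = orbit f m (i, j)" for i j
    by (rule spread_symmetric[OF sym] orbit_symmetric[OF sym])+
  fix i j :: int
  assume ij: "0 \<le> j" "j \<le> i"
  let ?x = "orbit f n"
  have far: "\<not> ?x (a, b)" if "\<bar>a\<bar> + \<bar>b\<bar> \<ge> int m" for a b
    using that x(2) by (intro orbit_outside[OF f]) auto
  have odd1: "?x (a, b)" if "odd (a + b)" "\<bar>a\<bar> + \<bar>b\<bar> < int m" for a b
    using x(1) that unfolding odd_filled_def by blast
  have odd2: "\<not> ?x (a, b)" if "odd a" "odd b" for a b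
    using x(1) that unfolding odd_filled_def by blast
  have step: "orbit f m (i, j) = f (?x (i, j)) (?x (i, j + 1)) (?x (i, j - 1)) (?x (i - 1, j)) (?x (i + 1, j))"
    unfolding x(2) by (rule orbit_Suc)
  have spread: "spread f m 0 (i, j) \<longleftrightarrow> i + j < int m \<or> (i = int m \<and> j = 0)"
    using ij m(2) by (auto simp: spread_def seed_def)
  have "i + j < int m \<or> i + j = int m \<or> i + j > int m" by linarith
  then show "orbit f m (i, j) = spread f m 0 (i, j)"
  proof (elim disjE)
    assume lt: "i + j < int m"
    have "orbit f m (i, j)"
    proof (cases "even (i + j)")
      case True
      \<comment> \<open>By parity the cell is not on the outermost layer, so all four neighbors lie
        in the diamond.\<close>
      moreover have "odd (int m - 1)" using m by simp
      ultimately have "i + j \<noteq> int m - 1" by metis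
      then have "?x (i, j + 1)" "?x (i, j - 1)" "?x (i - 1, j)" "?x (i + 1, j)"
        using True lt ij by (intro odd1; auto)+
      then show ?thesis by (simp add: step Tb_rule_values(11)[OF f])
    next
      case False
      then have c: "?x (i, j)" using lt ij by (intro odd1) auto
      show ?thesis
      proof (cases "even i")
        case True
        then have "\<not> ?x (i - 1, j)" "\<not> ?x (i + 1, j)" using False by (intro odd2; auto)+
        then show ?thesis using c Tb_rule_values(2,3,4,12)[OF f]
          by (cases "?x (i, j + 1)"; cases "?x (i, j - 1)") (simp_all add: step)
      next
        case odd: False
        then have "\<not> ?x (i, j - 1)" "\<not> ?x (i, j + 1)" using False by (intro odd2; auto)+
        then show ?thesis using c Tb_rule_values(2,5,6,13)[OF f]
          by (cases "?x (i + 1, j)"; cases "?x (i - 1, j)") (simp_all add: step)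
      qed
    qed
    then show ?thesis using lt spread by simp
  next
    assume eq: "i + j = int m"
    have out: "\<not> ?x (i, j)" "\<not> ?x (i, j + 1)" "\<not> ?x (i + 1, j)"
      using eq ij by (intro far; simp)+
    have ev: "even (i + j)" using eq m by simp
    have "odd (i - 1 + j)" "odd (i + (j - 1))" using ev by simp_all
    note prev = odd1[OF this(1)] odd1[OF this(2)]
    have i: "?x (i - 1, j)" using eq ij m by (intro prev) linarith
    show ?thesis
    proof (cases "j = 0")
      case True
      then have "\<not> ?x (i, j - 1)" using eq by (intro far) simp
      then show ?thesis unfolding step spread using True out i eq Tb_rule_values(5)[OF f] by simp
    next
      case False
      then have "?x (i, j - 1)" using False eq ij by (intro prev) linarith
      then show ?thesis using False out i eq Tb_rule_values(9)[OF f] by (simp add: step spread)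
    qed
  next
    assume gt: "i + j > int m"
    have "\<not> ?x (i, j)" "\<not> ?x (i, j + 1)" "\<not> ?x (i, j - 1)" "\<not> ?x (i - 1, j)" "\<not> ?x (i + 1, j)"
      using gt ij by (intro far; linarith)+
    then show ?thesis using gt Tb_rule_values(1)[OF f] ij by (simp add: step spread)
  qed
qed

text \<open>At step \<open>n = m - 1\<close> the central diamond is a single cell. The diagonals cut
  the diamond of size \<open>2 * m\<close> into four open sectors, each covered by the diamond of
  size \<open>m\<close> around one of the four centers; cells of odd sum avoid the diagonals.
  Translation by the even number \<open>m\<close> preserves parities.\<close>

lemma odd_filled_double:
  assumes f: "Tb_rule f" and m: "even m" "m > 0" and x: "odd_filled m (orbit f n)" "m = Suc n"
  shows "odd_filled (2 * m) (spread f m n)"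
proof -
  have odd1: "orbit f n (a, b)" if "odd (a + b)" "\<bar>a\<bar> + \<bar>b\<bar> < int m" for a b
    using x(1) that unfolding odd_filled_def by blast
  have odd2: "\<not> orbit f n (a, b)" if "odd a" "odd b" for a b
    using x(1) that unfolding odd_filled_def by blast
  have "spread f m n (i, j)" if o: "odd (i + j)" and l: "\<bar>i\<bar> + \<bar>j\<bar> < int (2 * m)" for i j
  proof -
    have o': "odd (i - j)" using o by simp
    have "i + j \<noteq> 0" "i - j \<noteq> 0" using o o' by (metis even_zero)+
    then consider "i + j > 0" "i - j > 0" | "i + j > 0" "i - j < 0" | "i + j < 0" "i - j > 0"
      | "i + j < 0" "i - j < 0" by linarith
    then have "\<bar>i - int m\<bar> + \<bar>j\<bar> < int m \<or> \<bar>i + int m\<bar> + \<bar>j\<bar> < int m \<or>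
        \<bar>i\<bar> + \<bar>j - int m\<bar> < int m \<or> \<bar>i\<bar> + \<bar>j + int m\<bar> < int m"
    proof cases
      case 1
      then have "\<bar>i - int m\<bar> + \<bar>j\<bar> < int m" using l by linarith
      then show ?thesis by blast
    next
      case 2
      then have "\<bar>i\<bar> + \<bar>j - int m\<bar> < int m" using l by linarith
      then show ?thesis by blast
    next
      case 3
      then have "\<bar>i\<bar> + \<bar>j + int m\<bar> < int m" using l by linarith
      then show ?thesis by blast
    next
      case 4
      then have "\<bar>i + int m\<bar> + \<bar>j\<bar> < int m" using l by linarith
      then show ?thesis by blast
    qed
    moreover have "odd (i - int m + j)" "odd (i + int m + j)" "odd (i + (j - int m))"
      "odd (i + (j + int m))" using o m by auto
    ultimately show ?thesis using odd1 unfolding spread_def prod.case by blast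
  qed
  moreover have "\<not> spread f m n (i, j)" if o: "odd i" "odd j" for i j
  proof -
    have "i \<noteq> 0" using o by auto
    then have "\<not> \<bar>i\<bar> + \<bar>j\<bar> < int m - int n" using x(2) by linarith
    moreover have "odd (i - int m)" "odd (i + int m)" "odd (j - int m)" "odd (j + int m)"
      using o m by auto
    ultimately show ?thesis using o odd2 by (simp add: spread_def)
  qed
  ultimately show ?thesis unfolding odd_filled_def by blast
qed

lemma odd_filled_orbit:
  assumes f: "Tb_rule f"
  shows "odd_filled (2 ^ Suc k) (orbit f (2 ^ Suc k - 1))"
proof (induction k)
  case 0
  have sym: "symmetrical f" using f by (simp add: Tb_rule_def)
  have tips: "orbit f 1 (1, 0)" "orbit f 1 (- 1, 0)" "orbit f 1 (0, 1)" "orbit f 1 (0, - 1)"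
    using orbit_tip[OF f, of 1] orbit_symmetric[OF sym, of 1 0 1] orbit_symmetric[OF sym, of 1 1 0]
      orbit_symmetric[OF sym, of 1 0 "-1"] by auto
  have "orbit f 1 (i, j)" if "odd (i + j)" "\<bar>i\<bar> + \<bar>j\<bar> < 2" for i j
  proof -
    have "\<bar>i\<bar> + \<bar>j\<bar> = 1" using that by (cases "i = 0 \<and> j = 0") auto
    then have "(i, j) \<in> {(1, 0), (- 1, 0), (0, 1), (0, - 1)}" by auto
    then show ?thesis using tips by auto
  qed
  moreover have "\<not> orbit f 1 (i, j)" if "odd i" "odd j" for i j
  proof (rule orbit_outside[OF f])
    have "i \<noteq> 0" "j \<noteq> 0" using that by auto
    then show "\<bar>i\<bar> + \<bar>j\<bar> > int 1" by linarith
  qed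
  ultimately have "odd_filled 2 (orbit f 1)" unfolding odd_filled_def by simp
  then show ?case by simp
next
  case (Suc k)
  let ?m = "2 ^ Suc k :: nat"
  have m: "even ?m" "?m > 0" "?m = Suc (?m - 1)" by simp_all
  have "orbit f (?m + (?m - 1)) = spread f ?m (?m - 1)"
    by (rule orbit_spread[OF f ca_map_odd_filled[OF f m(1,2) Suc.IH m(3)]]) simp
  moreover have "2 ^ Suc (Suc k) - 1 = ?m + (?m - 1)" "2 ^ Suc (Suc k) = 2 * ?m" by simp_all
  ultimately show ?case using odd_filled_double[OF f m(1,2) Suc.IH m(3)] by simp
qed

lemma orbit_power_two:
  assumes f: "Tb_rule f" and u: "u < 2 ^ k"
  shows "orbit f (2 ^ k + u) = spread f (2 ^ k) u"
proof (rule orbit_spread[OF f _ u])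
  show "orbit f (2 ^ k) = spread f (2 ^ k) 0"
  proof (cases k)
    \<comment> \<open>\<open>m = 1\<close> is odd, so the parity argument does not apply and the
      cells are checked one by one.\<close>
    case 0
    have sym: "symmetrical f" using f by (simp add: Tb_rule_def)
    have "orbit f 1 (i, j) = spread f 1 0 (i, j)" for i j
    proof -
      have tips: "orbit f 1 (1, 0)" "orbit f 1 (- 1, 0)" "orbit f 1 (0, 1)" "orbit f 1 (0, - 1)"
          "orbit f 1 (0, 0)"
        using orbit_tip[OF f, of 1] orbit_symmetric[OF sym, of 1 0 1] orbit_symmetric[OF sym, of 1 1 0]
          orbit_symmetric[OF sym, of 1 0 "-1"] orbit_previous_tip[OF f, of 0] by auto
      show ?thesis
      proof (cases "\<bar>i\<bar> + \<bar>j\<bar> \<le> 1")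
        case True
        then have "(i, j) \<in> {(0, 0), (1, 0), (- 1, 0), (0, 1), (0, - 1)}" by auto
        then show ?thesis using tips by (auto simp: spread_def seed_def)
      next
        case False
        then show ?thesis using orbit_outside[OF f, of 1 i j] by (auto simp: spread_def seed_def)
      qed
    qed
    then show ?thesis using 0 by auto
  next
    case (Suc k')
    show ?thesis unfolding Suc
      by (rule ca_map_odd_filled[OF f _ _ odd_filled_orbit[OF f]]) simp_all
  qed
qed

subsection \<open>The number of nonzero states\<close>

lemma card_diamond: "card {(i, j). \<bar>i\<bar> + \<bar>j\<bar> \<le> int r} = 2 * r * (r + 1) + 1"
proof -
  have "{(i, j). \<bar>i\<bar> + \<bar>j\<bar> \<le> int r} = (SIGMA i:{- int r..int r}. {- (int r - \<bar>i\<bar>)..int r - \<bar>i\<bar>})"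
    by auto
  then have "int (card {(i, j). \<bar>i\<bar> + \<bar>j\<bar> \<le> int r}) = (\<Sum>i = - int r..int r. 2 * (int r - \<bar>i\<bar>) + 1)"
    by (auto simp: card_SigmaI of_nat_sum intro!: sum.cong)
  also have "\<dots> = 2 * int r * (int r + 1) + 1"
  proof (induction r)
    case (Suc r)
    \<comment> \<open>A larger radius lengthens every old column by two cells and adds two columns
      of one cell each.\<close>
    have "{- int (Suc r)..int (Suc r)} = insert (- int (Suc r)) (insert (int (Suc r)) {- int r..int r})"
      by auto
    then have "(\<Sum>i = - int (Suc r)..int (Suc r). 2 * (int (Suc r) - \<bar>i\<bar>) + 1)
        = 2 + (\<Sum>i = - int r..int r. (2 * (int r - \<bar>i\<bar>) + 1) + 2)"
      by (simp add: algebra_simps)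
    also have "\<dots> = 2 + ((\<Sum>i = - int r..int r. 2 * (int r - \<bar>i\<bar>) + 1) + (\<Sum>i = - int r..int r. 2))"
      by (simp only: sum.distrib)
    also have "\<dots> = 2 + ((2 * int r * (int r + 1) + 1) + 2 * (2 * int r + 1))"
      unfolding Suc.IH by simp
    finally show ?case by (simp add: algebra_simps)
  qed simp
  finally have "int (card {(i, j). \<bar>i\<bar> + \<bar>j\<bar> \<le> int r}) = int (2 * r * (r + 1) + 1)"
    by (simp add: algebra_simps)
  then show ?thesis by (simp only: of_nat_eq_iff)
qed

text \<open>The cardinality is positive, whereas infinite sets have \<open>card\<close> equal to
  0.\<close>

lemma finite_diamond: "finite {(i, j). \<bar>i\<bar> + \<bar>j\<bar> \<le> int r}"
  using card_diamond[of r] card.infinite by fastforce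

text \<open>The five pieces are disjoint by the triangle inequality for \<open>|i| + |j|\<close>:
  two centers are \<open>2 * m\<close> apart and the copies have radius \<open>u < m\<close>; a
  center is at distance \<open>m\<close> from the origin, while \<open>u\<close> and the radius of
  the diamond add up to \<open>m - 1\<close>.\<close>

lemma card_spread:
  assumes f: "Tb_rule f" and u: "u < m"
  shows "card {p. spread f m u p} = 4 * card {p. orbit f u p} + card {(i, j). \<bar>i\<bar> + \<bar>j\<bar> \<le> int (m - Suc u)}"
proof -
  let ?X = "{p. orbit f u p}"
  let ?s = "\<lambda>a b (i, j). (i + a, j + b) :: int \<times> int"
  let ?E = "?s (int m) 0 ` ?X" and ?W = "?s (- int m) 0 ` ?X" and ?N = "?s 0 (int m) ` ?X"
    and ?S = "?s 0 (- int m) ` ?X" and ?D = "{(i, j). \<bar>i\<bar> + \<bar>j\<bar> \<le> int (m - Suc u)}"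
  have im: "?s a b ` ?X = {(i, j). orbit f u (i - a, j - b)}" for a b
    by (force simp: image_iff)
  have fin: "finite (?s a b ` ?X)" for a b
    using finite_support_orbit[OF f] by simp
  have card: "card (?s a b ` ?X) = card ?X" for a b
    by (rule card_image) (auto simp: inj_on_def)
  have eq: "{p. spread f m u p} = ?E \<union> (?W \<union> (?N \<union> (?S \<union> ?D)))"
    using u unfolding im by (auto simp: spread_def of_nat_diff)
  have sub: "\<bar>i - a\<bar> + \<bar>j - b\<bar> \<le> int u" if "(i, j) \<in> ?s a b ` ?X" for i j a b
    using orbit_support[OF f] that unfolding im by auto
  have disj1: "?s a b ` ?X \<inter> ?s c d ` ?X = {}" if "\<bar>a - c\<bar> + \<bar>b - d\<bar> = 2 * int m" for a b c d
  proof -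
    have *: False if "\<bar>i - a\<bar> + \<bar>j - b\<bar> \<le> int u" "\<bar>i - c\<bar> + \<bar>j - d\<bar> \<le> int u" for i j
    proof -
      have "\<bar>a - c\<bar> \<le> \<bar>i - a\<bar> + \<bar>i - c\<bar>" "\<bar>b - d\<bar> \<le> \<bar>j - b\<bar> + \<bar>j - d\<bar>" by linarith+
      from add_mono[OF this] have "2 * int m \<le> (\<bar>i - a\<bar> + \<bar>j - b\<bar>) + (\<bar>i - c\<bar> + \<bar>j - d\<bar>)"
        unfolding \<open>\<bar>a - c\<bar> + \<bar>b - d\<bar> = 2 * int m\<close>[symmetric] by (simp only: add_ac)
      also have "\<dots> \<le> int u + int u" using that by (rule add_mono)
      finally show False using u by simp
    qed
    show ?thesis
    proof (rule equals0I)
      fix p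
      assume p: "p \<in> ?s a b ` ?X \<inter> ?s c d ` ?X"
      obtain i j where "p = (i, j)" by (cases p)
      note p = p[unfolded this]
      show False by (rule *[OF sub[OF IntD1[OF p]] sub[OF IntD2[OF p]]])
    qed
  qed
  have disj2: "?s a b ` ?X \<inter> ?D = {}" if "\<bar>a\<bar> + \<bar>b\<bar> = int m" for a b
  proof -
    have *: False if "\<bar>i - a\<bar> + \<bar>j - b\<bar> \<le> int u" "\<bar>i\<bar> + \<bar>j\<bar> \<le> int (m - Suc u)" for i j
    proof -
      have "\<bar>a\<bar> \<le> \<bar>i - a\<bar> + \<bar>i\<bar>" "\<bar>b\<bar> \<le> \<bar>j - b\<bar> + \<bar>j\<bar>" by linarith+
      from add_mono[OF this] have "int m \<le> (\<bar>i - a\<bar> + \<bar>j - b\<bar>) + (\<bar>i\<bar> + \<bar>j\<bar>)"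
        unfolding \<open>\<bar>a\<bar> + \<bar>b\<bar> = int m\<close>[symmetric] by (simp only: add_ac)
      also have "\<dots> \<le> int u + int (m - Suc u)" using that by (rule add_mono)
      finally show False using u by simp
    qed
    show ?thesis
    proof (rule equals0I)
      fix p
      assume p: "p \<in> ?s a b ` ?X \<inter> ?D"
      obtain i j where "p = (i, j)" by (cases p)
      note p = p[unfolded this]
      show False by (rule *[OF sub[OF IntD1[OF p]] IntD2[OF p, unfolded mem_Collect_eq prod.case]])
    qed
  qed
  have disj: "?E \<inter> (?W \<union> (?N \<union> (?S \<union> ?D))) = {}" "?W \<inter> (?N \<union> (?S \<union> ?D)) = {}" "?N \<inter> (?S \<union> ?D) = {}"
    "?S \<inter> ?D = {}"
    unfolding Int_Un_distrib Un_empty by (intro conjI disj1 disj2; simp)+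
  show ?thesis
    unfolding eq by (simp only: card_Un_disjoint fin finite_diamond finite_Un simp_thms disj card)
qed

text \<open>Since \<open>num_b f t\<close> counts at time \<open>t - 1\<close>, this is
  \<open>card_spread\<close> with \<open>u = s - 1\<close>, and the diamond left has radius
  \<open>2 ^ k - s\<close>. The formula fails for \<open>s = 0\<close>, where \<open>num_b\<close>
  is 0 by convention.\<close>

lemma num_b_power_two_add:
  assumes f: "Tb_rule f" and s: "0 < s" "s \<le> 2 ^ k"
  shows "num_b f (2 ^ k + s) = 4 * num_b f s + (2 * (2 ^ k - real s) * (2 ^ k - real s + 1) + 1)"
proof -
  have "2 ^ k + s - 1 = 2 ^ k + (s - 1)" using s by simp
  then have "num_b f (2 ^ k + s) = real (card {p. spread f (2 ^ k) (s - 1) p})"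
    using s orbit_power_two[OF f, of "s - 1" k] by (simp add: num_b_eq_card[OF f])
  also have "\<dots> = real (4 * card {p. orbit f (s - 1) p} + (2 * (2 ^ k - s) * ((2 ^ k - s) + 1) + 1))"
    using s by (subst card_spread[OF f]) (auto simp only: card_diamond, auto)
  also have "\<dots> = 4 * num_b f s + (2 * (2 ^ k - real s) * (2 ^ k - real s + 1) + 1)"
  proof -
    have *: "2 ^ k - real s = real (2 ^ k - s)" using s by (simp add: of_nat_diff)
    show ?thesis
      unfolding * using s by (simp only: num_b_eq_card[OF f] of_nat_add of_nat_mult) simp
  qed
  finally show ?thesis .
qed

lemma num_b_one: "Tb_rule f \<Longrightarrow> num_b f 1 = 1"
  by (simp add: num_b_eq_card seed_def)

lemma num_b_power_two:
  assumes f: "Tb_rule f"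
  shows "num_b f (2 ^ k) = (4 * 4 ^ k - 1) / 3"
proof (induction k)
  case (Suc k)
  \<comment> \<open>For \<open>s = 2 ^ k\<close> the diamond is reduced to one cell.\<close>
  have "num_b f (2 ^ Suc k) = 4 * num_b f (2 ^ k) + 1"
    using num_b_power_two_add[OF f, of "2 ^ k" k] by (simp add: mult_2)
  then show ?case using Suc by (simp add: field_simps)
qed (use num_b_one[OF f] in simp)

text \<open>The light cone at time \<open>t - 1\<close> gives the quadratic bound, which makes the
  counts divided by \<open>4 ^ k\<close> uniformly bounded.\<close>

lemma num_b_bounds:
  assumes f: "Tb_rule f"
  shows "0 \<le> num_b f t" "num_b f t \<le> 2 * (real t)\<^sup>2"
proof -
  have "0 \<le> num_b f t \<and> num_b f t \<le> 2 * (real t)\<^sup>2"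
  proof (cases t)
    case 0
    then show ?thesis by (simp add: num_b_def)
  next
    case (Suc n)
    have "card {p. orbit f n p} \<le> card {(i, j). \<bar>i\<bar> + \<bar>j\<bar> \<le> int n}"
      using orbit_support[OF f] by (intro card_mono finite_diamond) auto
    also have "\<dots> \<le> 2 * t\<^sup>2" unfolding card_diamond Suc by (simp add: power2_eq_square)
    finally have "real (card {p. orbit f n p}) \<le> real (2 * t\<^sup>2)" by (rule of_nat_mono)
    then show ?thesis using Suc by (simp add: num_b_eq_card[OF f])
  qed
  then show "0 \<le> num_b f t" "num_b f t \<le> 2 * (real t)\<^sup>2" by auto
qed

subsection \<open>Riemann integrability\<close>

lemma frontier_interval_finite: "finite (frontier {u..v::real})"
  by (rule finite_subset[of _ "{u, v}"]) (auto simp: frontier_def interior_atLeastAtMost_real)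

text \<open>Each summand is integrated separately, so it does not matter that intervals of the
  division share end points.\<close>

lemma riemann_sum_has_integral:
  fixes g :: "real \<Rightarrow> real"
  assumes p: "p tagged_division_of {a..b}"
  shows "((\<lambda>y. \<Sum>(x, K)\<in>p. g x * indicator K y) has_integral (\<Sum>(x, K)\<in>p. measure lborel K * g x)) {a..b}"
  unfolding case_prod_beta
proof (rule has_integral_sum)
  show "finite p" using p by auto
  fix q
  assume q: "q \<in> p"
  then obtain u v where K: "snd q = {u..v}"
    using tagged_division_ofD(4)[OF p, of "fst q" "snd q"] by auto
  have "snd q \<subseteq> {a..b}" using tagged_division_ofD(3)[OF p, of "fst q" "snd q"] q by simp
  moreover have "((\<lambda>_. g (fst q)) has_integral (measure lborel (snd q) * g (fst q))) (snd q)"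
    unfolding K using has_integral_const_real[of "g (fst q)" u v] by simp
  ultimately have "((\<lambda>y. if y \<in> snd q then g (fst q) else 0) has_integral
      (measure lborel (snd q) * g (fst q))) {a..b}"
    by (simp only: has_integral_restrict)
  then show "((\<lambda>y. g (fst q) * indicator (snd q) y) has_integral (measure lborel (snd q) * g (fst q))) {a..b}"
    by (rule has_integral_eq[rotated]) simp
qed

text \<open>Away from the frontiers, \<open>y\<close> is interior to every interval containing it.
  Interiors are disjoint, so only one summand remains.\<close>

lemma tagged_division_step_value:
  fixes g :: "real \<Rightarrow> real"
  assumes p: "p tagged_division_of {a..b}" and y: "y \<in> {a..b}" "\<And>x K. (x, K) \<in> p \<Longrightarrow> y \<notin> frontier K"
  obtains x K where "(x, K) \<in> p" "x \<in> K" "y \<in> K" "(\<Sum>(x, K)\<in>p. g x * indicator K y) = g x"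
proof -
  obtain x K where xK: "(x, K) \<in> p" "y \<in> K"
    using tagged_division_ofD(6)[OF p] y(1) by blast
  have int: "y \<in> interior K'" if "(x', K') \<in> p" "y \<in> K'" for x' K'
    using y(2)[OF that(1)] that(2) closure_subset by (auto simp: frontier_def)
  have "(\<Sum>(x, K)\<in>p. g x * indicator K y) = (\<Sum>(x, K)\<in>{(x, K)}. g x * indicator K y)"
  proof (rule sum.mono_neutral_right)
    show "finite p" using p by auto
    show "{(x, K)} \<subseteq> p" using xK by simp
    show "\<forall>q\<in>p - {(x, K)}. (case q of (x, K) \<Rightarrow> g x * indicator K y) = 0"
      using tagged_division_ofD(5)[OF p xK(1)] int[OF xK] int by (fastforce simp: indicator_def)
  qed
  also have "\<dots> = g x" using xK by simp
  finally show thesis using that[OF xK(1) tagged_division_ofD(2)[OF p xK(1)] xK(2)] by blast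
qed

text \<open>Off the null set \<open>E\<close> of discontinuities and end points, the step function
  takes at \<open>y\<close> the value of \<open>g\<close> at a tag closer and closer to
  \<open>y\<close>.\<close>

lemma riemann_sums_tendsto:
  fixes g :: "real \<Rightarrow> real"
  assumes bnd: "\<And>x. x \<in> {a..b} \<Longrightarrow> \<bar>g x\<bar> \<le> B" and C: "countable C"
    and cont: "\<And>x. x \<in> {a..b} - C \<Longrightarrow> continuous (at x within {a..b}) g"
    and p: "\<And>n. p n tagged_division_of {a..b}"
    and mesh: "\<And>n x K. (x, K) \<in> p n \<Longrightarrow> measure lborel K < 1 / real (Suc n)"
  shows "(\<lambda>n. \<Sum>(x, K)\<in>p n. measure lborel K * g x) \<longlonglongrightarrow> integral {a..b} g"
proof -
  define E where "E = C \<union> (\<Union>n. \<Union>(x, K)\<in>p n. frontier K)"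
  have "finite (\<Union>(x, K)\<in>p n. frontier K)" for n
  proof (rule finite_UN_I)
    show "finite (p n)" using p[of n] by auto
    show "finite (case q of (x, K) \<Rightarrow> frontier K)" if "q \<in> p n" for q
      using tagged_division_ofD(4)[OF p[of n], of "fst q" "snd q"] that frontier_interval_finite
      by (auto split: prod.split)
  qed
  then have ends: "countable (\<Union>(x, K)\<in>p n. frontier K)" for n by (rule countable_finite)
  have "countable E"
    unfolding E_def by (rule countable_Un[OF C countable_UN[OF countableI_type ends]])
  then have E: "negligible E"
    using negligible_countable_Union[of "(\<lambda>x. {x}) ` E"] by auto
  define F where "F n y = (\<Sum>(x, K)\<in>p n. g x * indicator K y)" for n y
  \<comment> \<open>Setting the values on \<open>E\<close> to 0 makes convergence and domination
    hold at every point of the interval.\<close>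
  define h where "h n y = (if y \<in> E then 0 else F n y)" for n y
  define g' where "g' y = (if y \<in> E then 0 else g y)" for y
  have tag: "\<exists>x. x \<in> {a..b} \<and> F n y = g x \<and> \<bar>x - y\<bar> \<le> 1 / real (Suc n)" if y: "y \<in> {a..b}" "y \<notin> E" for n y
  proof -
    obtain x K where xK: "(x, K) \<in> p n" "x \<in> K" "y \<in> K" "(\<Sum>(x, K)\<in>p n. g x * indicator K y) = g x"
    proof (rule tagged_division_step_value[OF p y(1), of n])
      show "y \<notin> frontier K" if "(x, K) \<in> p n" for x K using y(2) that unfolding E_def by blast
    qed
    obtain u v where K: "K = {u..v}" using tagged_division_ofD(4)[OF p xK(1)] by auto
    have "x \<in> {a..b}" using tagged_division_ofD(3)[OF p xK(1)] xK(2) by blast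
    moreover have "\<bar>x - y\<bar> \<le> 1 / real (Suc n)"
      using mesh[OF xK(1)] xK(2,3) unfolding K by auto
    ultimately show ?thesis using xK(4) unfolding F_def by blast
  qed
  have h: "(h n has_integral (\<Sum>(x, K)\<in>p n. measure lborel K * g x)) {a..b}" for n
    by (rule has_integral_spike[OF E _ riemann_sum_has_integral[OF p]]) (simp add: h_def F_def)
  have lim: "(\<lambda>n. h n y) \<longlonglongrightarrow> g' y" if y: "y \<in> {a..b}" for y
  proof (cases "y \<in> E")
    case False
    then obtain z where z: "\<And>n. z n \<in> {a..b}" "\<And>n. F n y = g (z n)" "\<And>n. \<bar>z n - y\<bar> \<le> 1 / real (Suc n)"
      using tag[OF y] by metis
    have "(\<lambda>n. z n - y) \<longlonglongrightarrow> 0"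
      by (rule tendsto_rabs_zero_cancel, rule tendsto_sandwich[OF _ _ tendsto_const LIMSEQ_inverse_real_of_nat])
        (use z(3) in \<open>auto simp: inverse_eq_divide\<close>)
    then have "z \<longlonglongrightarrow> y" by (simp add: LIM_zero_iff)
    moreover have "continuous (at y within {a..b}) g" using y False by (intro cont) (simp add: E_def)
    ultimately have "(\<lambda>n. g (z n)) \<longlonglongrightarrow> g y"
      using z(1) unfolding continuous_within_sequentially comp_def by blast
    then show ?thesis using False by (simp add: h_def g'_def z(2))
  qed (simp add: h_def g'_def)
  have le: "norm (h n y) \<le> \<bar>B\<bar>" if "y \<in> {a..b}" for n y
    using tag[OF that, of n] bnd by (fastforce simp: h_def)
  have "(\<lambda>n. integral {a..b} (h n)) \<longlonglongrightarrow> integral {a..b} g'"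
    by (rule dominated_convergence(2)[OF _ _ le lim]) (use h in blast, auto)
  moreover have "integral {a..b} g' = integral {a..b} g"
    by (rule integral_spike[OF E]) (simp add: g'_def)
  ultimately show ?thesis using integral_unique[OF h] by simp
qed

text \<open>The Riemann sums are integrals of step functions that converge at every point of
  continuity, so the dominated convergence theorem applies.\<close>

lemma has_riemann_integral_countable_discontinuities:
  fixes g :: "real \<Rightarrow> real"
  assumes bnd: "\<And>x. x \<in> {a..b} \<Longrightarrow> \<bar>g x\<bar> \<le> B" and C: "countable C"
    and cont: "\<And>x. x \<in> {a..b} - C \<Longrightarrow> continuous (at x within {a..b}) g"
  shows "has_riemann_integral g (integral {a..b} g) a b"
proof (rule ccontr)
  let ?S = "\<lambda>p. \<Sum>(x, K)\<in>p. measure lborel K * g x"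
  assume "\<not> ?thesis"
  then obtain e where e: "e > 0" and
    "\<forall>d>0. \<exists>p. p tagged_division_of {a..b} \<and> (\<forall>(x, K)\<in>p. measure lborel K < d) \<and>
       \<not> \<bar>?S p - integral {a..b} g\<bar> < e"
    unfolding has_riemann_integral_def by metis
  \<comment> \<open>A failure for every mesh yields a sequence of divisions with mesh below
    \<open>1 / Suc n\<close>.\<close>
  then have "\<forall>n. \<exists>p. p tagged_division_of {a..b} \<and> (\<forall>(x, K)\<in>p. measure lborel K < 1 / real (Suc n)) \<and>
       \<not> \<bar>?S p - integral {a..b} g\<bar> < e"
    by (metis of_nat_0_less_iff zero_less_Suc zero_less_divide_1_iff)
  then obtain p where p: "\<And>n. p n tagged_division_of {a..b}"
    "\<And>n. \<forall>(x, K)\<in>p n. measure lborel K < 1 / real (Suc n)"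
    "\<And>n. \<not> \<bar>?S (p n) - integral {a..b} g\<bar> < e" by metis
  have "(\<lambda>n. ?S (p n)) \<longlonglongrightarrow> integral {a..b} g"
    by (rule riemann_sums_tendsto[OF bnd C cont p(1)]) (use p(2) in auto)
  with e have "eventually (\<lambda>n. \<bar>?S (p n) - integral {a..b} g\<bar> < e) sequentially"
    by (auto dest: tendstoD simp: dist_real_def)
  with p(3) show False by simp
qed

text \<open>Read \<open>Q x c\<close> as an error estimate \<open>c\<close> at \<open>x\<close>. The induction follows the binary expansion of
  \<open>x\<close> that does not end in zeros: each digit 0 gains a factor 4, and only finitely many digits 1 precede it unless \<open>x = 1\<close>.\<close>

lemma binary_contraction:
  fixes Q :: "real \<Rightarrow> real \<Rightarrow> bool"
  assumes D: "D \<subseteq> {0<..1}"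
    and low: "\<And>x. x \<in> D \<Longrightarrow> x \<le> 1 / 2 \<Longrightarrow> 2 * x \<in> D"
      "\<And>x c. x \<in> D \<Longrightarrow> x \<le> 1 / 2 \<Longrightarrow> Q (2 * x) c \<Longrightarrow> Q x (c / 4)"
    and high: "\<And>x. x \<in> D \<Longrightarrow> 1 / 2 < x \<Longrightarrow> x < 1 \<Longrightarrow> 2 * x - 1 \<in> D"
      "\<And>x c. x \<in> D \<Longrightarrow> 1 / 2 < x \<Longrightarrow> x < 1 \<Longrightarrow> Q (2 * x - 1) c \<Longrightarrow> Q x c"
    and one: "\<And>c. 1 \<in> D \<Longrightarrow> c > 0 \<Longrightarrow> Q 1 c"
    and start: "\<And>x. x \<in> D \<Longrightarrow> Q x M" and M: "M > 0"
  shows "x \<in> D \<Longrightarrow> Q x (M / 4 ^ n)"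
proof (induction n arbitrary: x)
  case 0
  then show ?case using start by simp
next
  case (Suc n)
  let ?c = "M / 4 ^ Suc n"
  \<comment> \<open>The distance \<open>1 - y\<close> doubles under passing to
    \<open>2 * y - 1\<close>, so \<open>m\<close> bounds the number of leading digits 1. For
    \<open>m = 0\<close> no point of \<open>D\<close> is left.\<close>
  have aux: "y \<in> D \<Longrightarrow> y \<le> 1 - 1 / 2 ^ m \<Longrightarrow> Q y ?c" for m y
  proof (induction m arbitrary: y)
    case 0
    then show ?case using D by auto
  next
    case (Suc m)
    show ?case
    proof (cases "y \<le> 1 / 2")
      case True
      have "Q y (M / 4 ^ n / 4)"
        by (rule low(2)[OF Suc.prems(1) True \<open>\<And>x. x \<in> D \<Longrightarrow> Q x (M / 4 ^ n)\<close>[OF low(1)[OF Suc.prems(1) True]]])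
      then show ?thesis by (simp add: mult.commute)
    next
      case False
      moreover have "0 < 1 / (2::real) ^ Suc m" by simp
      then have "y < 1" using Suc.prems(2) by linarith
      moreover have "2 * y - 1 \<le> 1 - 1 / 2 ^ m" using Suc.prems(2) by (simp add: field_simps)
      ultimately show ?thesis using high Suc by (meson not_le)
    qed
  qed
  show ?case
  proof (cases "x = 1")
    case True
    then show ?thesis using one Suc.prems M by simp
  next
    case False
    then have "1 - x > 0" using D Suc.prems by force
    then obtain m where "(1 / 2) ^ m < 1 - x" using real_arch_pow_inv[of "1 - x" "1 / 2"] by auto
    then have "x \<le> 1 - 1 / 2 ^ m" by (simp add: power_one_over)
    then show ?thesis using aux Suc.prems by blast
  qed
qed

subsection \<open>The limit function\<close>

lemma floor_scaled_tendsto: "(\<lambda>k. of_int \<lfloor>2 ^ k * x\<rfloor> / 2 ^ k) \<longlonglongrightarrow> (x :: real)"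
proof (rule tendsto_sandwich)
  show "\<forall>\<^sub>F k in sequentially. x - (1 / 2) ^ k \<le> of_int \<lfloor>2 ^ k * x\<rfloor> / 2 ^ k"
  proof (intro always_eventually allI)
    fix k
    have "2 ^ k * x - 1 \<le> of_int \<lfloor>2 ^ k * x\<rfloor>" by linarith
    then have "(2 ^ k * x - 1) / 2 ^ k \<le> of_int \<lfloor>2 ^ k * x\<rfloor> / 2 ^ k" by (rule divide_right_mono) simp
    then show "x - (1 / 2) ^ k \<le> of_int \<lfloor>2 ^ k * x\<rfloor> / 2 ^ k"
      by (simp add: diff_divide_distrib power_one_over)
  qed
  show "\<forall>\<^sub>F k in sequentially. of_int \<lfloor>2 ^ k * x\<rfloor> / 2 ^ k \<le> x"
    by (intro always_eventually allI) (simp add: divide_le_eq mult.commute)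
  have "(\<lambda>k. x - (1 / 2) ^ k) \<longlonglongrightarrow> x - 0"
    by (intro tendsto_intros LIMSEQ_power_zero) simp
  then show "(\<lambda>k. x - (1 / 2) ^ k) \<longlonglongrightarrow> x" by simp
qed simp

text \<open>The number of cells in a diamond of radius \<open>w * 2 ^ k\<close>, divided by
  \<open>4 ^ Suc k\<close>: the contribution of the eroding diamond after scaling.\<close>

definition correction :: "nat \<Rightarrow> real \<Rightarrow> real" where
  "correction k y = (let w = 1 - of_int \<lfloor>2 ^ k * y\<rfloor> / 2 ^ k in (2 * w * (w + 1 / 2 ^ k) + 1 / 4 ^ k) / 4)"

lemma correction_tendsto: "(\<lambda>k. correction k (2 * x - 1)) \<longlonglongrightarrow> 2 * (1 - x)\<^sup>2"
proof -
  have "(\<lambda>k. 1 / (2::real) ^ k) \<longlonglongrightarrow> 0" "(\<lambda>k. 1 / (4::real) ^ k) \<longlonglongrightarrow> 0"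
    using LIMSEQ_power_zero[of "1 / 2 :: real"] LIMSEQ_power_zero[of "1 / 4 :: real"]
    by (simp_all add: power_one_over)
  then have "(\<lambda>k. correction k (2 * x - 1)) \<longlonglongrightarrow>
      (2 * (1 - (2 * x - 1)) * ((1 - (2 * x - 1)) + 0) + 0) / 4"
    unfolding correction_def Let_def by (intro tendsto_intros floor_scaled_tendsto) simp_all
  also have "(2 * (1 - (2 * x - 1)) * ((1 - (2 * x - 1)) + 0) + 0) / 4 = 2 * (1 - x)\<^sup>2"
    by (simp add: power2_eq_square field_simps)
  finally show ?thesis .
qed

text \<open>The oscillation of \<open>s\<close> at infinity is at most \<open>c\<close>. Quantifying
  over \<open>e > c\<close> leaves room to add a convergent sequence without increasing
  \<open>c\<close>.\<close>

definition almost_Cauchy :: "(nat \<Rightarrow> real) \<Rightarrow> real \<Rightarrow> bool" where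
  "almost_Cauchy s c \<longleftrightarrow> (\<forall>e>c. \<exists>K. \<forall>k\<ge>K. \<forall>l\<ge>K. \<bar>s k - s l\<bar> < e)"

lemma almost_Cauchy_Suc: "almost_Cauchy (\<lambda>k. s (Suc k)) c \<Longrightarrow> almost_Cauchy s c"
proof -
  assume s: "almost_Cauchy (\<lambda>k. s (Suc k)) c"
  have "\<exists>K. \<forall>k\<ge>K. \<forall>l\<ge>K. \<bar>s k - s l\<bar> < e" if e: "c < e" for e
  proof -
    obtain K where K: "\<And>k l. k \<ge> K \<Longrightarrow> l \<ge> K \<Longrightarrow> \<bar>s (Suc k) - s (Suc l)\<bar> < e"
      using s e unfolding almost_Cauchy_def by meson
    have "\<bar>s k - s l\<bar> < e" if "k \<ge> Suc K" "l \<ge> Suc K" for k l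
      using K[of "k - 1" "l - 1"] that by simp
    then show ?thesis by blast
  qed
  then show ?thesis unfolding almost_Cauchy_def by blast
qed

lemma almost_Cauchy_add_convergent:
  assumes s: "almost_Cauchy s c" and t: "convergent t" and r: "\<forall>\<^sub>F k in sequentially. r k = s k + t k"
  shows "almost_Cauchy r c"
  unfolding almost_Cauchy_def
proof (intro allI impI)
  fix e assume "e > c"
  then have "(c + e) / 2 > c" "(e - c) / 2 > 0" by simp_all
  then obtain K1 K2 where K1: "\<And>k l. k \<ge> K1 \<Longrightarrow> l \<ge> K1 \<Longrightarrow> \<bar>s k - s l\<bar> < (c + e) / 2"
    and K2: "\<And>k l. k \<ge> K2 \<Longrightarrow> l \<ge> K2 \<Longrightarrow> \<bar>t k - t l\<bar> < (e - c) / 2"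
    using s convergent_Cauchy[OF t] unfolding almost_Cauchy_def Cauchy_def dist_real_def by meson
  obtain K3 where K3: "\<And>k. k \<ge> K3 \<Longrightarrow> r k = s k + t k"
    using r unfolding eventually_sequentially by blast
  have "\<bar>r k - r l\<bar> < e" if "k \<ge> Max {K1, K2, K3}" "l \<ge> Max {K1, K2, K3}" for k l
  proof -
    have "r k - r l = (s k - s l) + (t k - t l)" using K3 that by simp
    moreover have "\<bar>s k - s l\<bar> < (c + e) / 2" "\<bar>t k - t l\<bar> < (e - c) / 2" using K1 K2 that by simp_all
    ultimately show ?thesis by (simp add: abs_if field_simps split: if_splits)
  qed
  then show "\<exists>K. \<forall>k\<ge>K. \<forall>l\<ge>K. \<bar>r k - r l\<bar> < e" by blast
qed

section \<open>Dyadic numbers\<close>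

definition dyadics :: "real set" where
  "dyadics = (\<Union>k. (\<lambda>m. of_int m / 2 ^ k) ` UNIV)"

lemma countable_dyadics: "countable dyadics"
  unfolding dyadics_def by (intro countable_UN countable_image countableI_type)

lemma dyadics_half: "2 * x \<in> dyadics \<Longrightarrow> x \<in> dyadics"
proof -
  assume "2 * x \<in> dyadics"
  then obtain k m where "2 * x = of_int m / 2 ^ k" unfolding dyadics_def by blast
  then have "x = of_int m / 2 ^ Suc k" by (simp add: field_simps)
  then show ?thesis unfolding dyadics_def by blast
qed

lemma dyadics_diff_one: "x - 1 \<in> dyadics \<Longrightarrow> x \<in> dyadics"
proof -
  assume "x - 1 \<in> dyadics"
  then obtain k m where "x - 1 = of_int m / 2 ^ k" unfolding dyadics_def by blast
  then have "x = of_int (m + 2 ^ k) / 2 ^ k" by (simp add: field_simps)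
  then show ?thesis unfolding dyadics_def by blast
qed

lemma dyadics_simps: "0 \<in> dyadics" "1 \<in> dyadics" "1 / 2 \<in> dyadics"
proof -
  have "0 = real_of_int 0 / 2 ^ 0" "1 = real_of_int 1 / 2 ^ 0" "1 / 2 = real_of_int 1 / 2 ^ 1" by simp_all
  then show "0 \<in> dyadics" "1 \<in> dyadics" "1 / 2 \<in> dyadics" unfolding dyadics_def by blast+
qed

section \<open>Scaled counts and their limit\<close>

context
  fixes f :: local_rule
  assumes f: "Tb_rule f"
begin

text \<open>Dividing by \<open>4 ^ k\<close> instead of \<^term>\<open>num_b f (2 ^ k)\<close> makes the recursion on \<open>x \<le> 1/2\<close> exact; the
  limit \<open>profile\<close> below is thus \<open>4/3\<close> of the function \<open>G\<close>.\<close>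

definition scaled :: "nat \<Rightarrow> real \<Rightarrow> real" where
  "scaled k x = num_b f (nat \<lfloor>2 ^ k * x\<rfloor>) / 4 ^ k"

lemma scaled_Suc_low: "scaled (Suc k) x = scaled k (2 * x) / 4"
  by (simp add: scaled_def mult.left_commute mult.assoc)

lemma scaled_bounds:
  assumes "0 \<le> x" "x \<le> 1"
  shows "0 \<le> scaled k x" "scaled k x \<le> 2"
proof -
  let ?t = "nat \<lfloor>2 ^ k * x\<rfloor>"
  show "0 \<le> scaled k x" using num_b_bounds(1)[OF f] by (simp add: scaled_def)
  have "0 \<le> 2 ^ k * x" using assms by simp
  then have "real ?t \<le> 2 ^ k * x" by linarith
  also have "\<dots> \<le> 2 ^ k" using assms by simp
  finally have "(real ?t)\<^sup>2 \<le> (2 ^ k)\<^sup>2" by (rule power_mono) simp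
  then have "num_b f ?t \<le> 2 * (2 ^ k)\<^sup>2" using num_b_bounds(2)[OF f, of ?t] by linarith
  also have "((2::real) ^ k)\<^sup>2 = 4 ^ k" by (simp add: power2_eq_square flip: power_mult_distrib)
  finally show "scaled k x \<le> 2" by (simp add: scaled_def field_simps)
qed

text \<open>Removing the leading digit 1 turns the argument of \<open>num_b\<close> into
  \<open>2 ^ k + s\<close> with \<open>s\<close> the integer part of
  \<open>2 ^ k * (2 * x - 1)\<close>. The recursion requires \<open>s > 0\<close>, which holds once
  \<open>2 ^ k\<close> reaches \<open>1 / (2 * x - 1)\<close>.\<close>

lemma scaled_Suc_high:
  assumes x: "1 / 2 < x" "x \<le> 1"
  shows "\<forall>\<^sub>F k in sequentially. scaled (Suc k) x = scaled k (2 * x - 1) + correction k (2 * x - 1)"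
proof -
  let ?y = "2 * x - 1"
  obtain n where n: "1 / ?y < 2 ^ n" using real_arch_pow[of 2 "1 / ?y"] by auto
  have "\<forall>\<^sub>F k in sequentially. 1 / ?y \<le> 2 ^ k"
  proof (rule eventually_sequentiallyI)
    show "1 / ?y \<le> 2 ^ k" if "n \<le> k" for k
      using n power_increasing[OF that, of "2 :: real"] by linarith
  qed
  then show ?thesis
  proof eventually_elim
    case (elim k)
    let ?s = "nat \<lfloor>2 ^ k * ?y\<rfloor>"
    have "1 \<le> 2 ^ k * ?y" using elim x by (simp add: divide_le_eq)
    then have s1: "0 < ?s" by linarith
    have "2 ^ k * ?y \<le> 2 ^ k" using x by simp
    then have "\<lfloor>2 ^ k * ?y\<rfloor> \<le> \<lfloor>(2::real) ^ k\<rfloor>" by (rule floor_mono)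
    also have "\<dots> = 2 ^ k" using floor_of_int[of "2 ^ k"] by simp
    finally have s2: "?s \<le> 2 ^ k" by (simp add: nat_le_iff)
    have "2 ^ Suc k * x = 2 ^ k * ?y + of_int (2 ^ k)" by (simp add: algebra_simps)
    then have "\<lfloor>2 ^ Suc k * x\<rfloor> = \<lfloor>2 ^ k * ?y\<rfloor> + 2 ^ k" by (simp only: floor_add_int[symmetric])
    also have "\<dots> = int (2 ^ k + ?s)" using s1 by simp
    finally have t: "nat \<lfloor>2 ^ Suc k * x\<rfloor> = 2 ^ k + ?s" by (simp only: nat_int)
    have s: "real_of_int \<lfloor>2 ^ k * ?y\<rfloor> = real ?s" using s1 by simp
    have "scaled (Suc k) x = (4 * num_b f ?s + (2 * (2 ^ k - real ?s) * (2 ^ k - real ?s + 1) + 1)) / 4 ^ Suc k"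
      unfolding scaled_def t num_b_power_two_add[OF f s1 s2] ..
    also have "\<dots> = scaled k ?y + (2 * (2 ^ k - real ?s) * (2 ^ k - real ?s + 1) + 1) / 4 ^ Suc k"
      by (simp add: scaled_def add_divide_distrib)
    also have "(2 * (2 ^ k - real ?s) * (2 ^ k - real ?s + 1) + 1) / 4 ^ Suc k = correction k ?y"
    proof -
      have "(4::real) ^ k = 2 ^ k * 2 ^ k" by (simp flip: power_mult_distrib)
      then show ?thesis unfolding correction_def Let_def s by (simp add: field_simps)
    qed
    finally show ?case .
  qed
qed

text \<open>The point 1 is fixed by passing to \<open>2 * x - 1\<close>, so
  \<open>binary_contraction\<close> leaves it to this explicit count. The same limit normalizes
  \<open>G_lim\<close>.\<close>

lemma scaled_one_tendsto: "(\<lambda>k. scaled k 1) \<longlonglongrightarrow> 4 / 3"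
proof -
  have "scaled k 1 = 4 / 3 - (1 / 3) * (1 / 4) ^ k" for k
  proof -
    have "\<lfloor>(2::real) ^ k\<rfloor> = 2 ^ k" using floor_of_int[of "2 ^ k"] by simp
    then have *: "nat \<lfloor>(2::real) ^ k * 1\<rfloor> = 2 ^ k" by (simp add: nat_power_eq)
    show ?thesis unfolding scaled_def * num_b_power_two[OF f] by (simp add: field_simps)
  qed
  moreover have "(\<lambda>k. 4 / 3 - (1 / 3) * (1 / 4) ^ k) \<longlonglongrightarrow> 4 / 3 - (1 / 3) * (0::real)"
    by (intro tendsto_intros LIMSEQ_power_zero) simp
  ultimately show ?thesis by simp
qed

text \<open>The oscillation at infinity starts at 2 by \<open>scaled_bounds\<close>, is divided by 4
  at a digit 0 and is kept at a digit 1, where the correction converges. Hence it is 0.\<close>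

lemma scaled_convergent:
  assumes "0 \<le> x" "x \<le> 1"
  shows "convergent (\<lambda>k. scaled k x)"
proof (cases "x = 0")
  case True
  then show ?thesis by (simp add: scaled_def num_b_def convergent_const)
next
  case False
  let ?Q = "\<lambda>x. almost_Cauchy (\<lambda>k. scaled k x)"
  have "?Q x (2 / 4 ^ n)" for n
  proof (rule binary_contraction[of "{0<..1}"])
    show "x \<in> {0<..1}" using assms False by simp
    show "?Q x (c / 4)" if Q: "?Q (2 * x) c" for x c
    proof (rule almost_Cauchy_Suc)
      show "almost_Cauchy (\<lambda>k. scaled (Suc k) x) (c / 4)"
        unfolding almost_Cauchy_def
      proof (intro allI impI)
        fix e assume "c / 4 < e"
        then have "4 * e > c" by simp
        then obtain K where
          K: "\<And>k l. k \<ge> K \<Longrightarrow> l \<ge> K \<Longrightarrow> \<bar>scaled k (2 * x) - scaled l (2 * x)\<bar> < 4 * e"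
          using Q unfolding almost_Cauchy_def by meson
        have "\<bar>scaled (Suc k) x - scaled (Suc l) x\<bar> < e" if "k \<ge> K" "l \<ge> K" for k l
          unfolding scaled_Suc_low using K[OF that] by linarith
        then show "\<exists>K. \<forall>k\<ge>K. \<forall>l\<ge>K. \<bar>scaled (Suc k) x - scaled (Suc l) x\<bar> < e" by blast
      qed
    qed
    show "?Q x c" if x: "x \<in> {0<..1}" "1 / 2 < x" and Q: "?Q (2 * x - 1) c" for x c
    proof (rule almost_Cauchy_Suc)
      have "x \<le> 1" using x(1) by simp
      from almost_Cauchy_add_convergent[OF Q convergentI[OF correction_tendsto] scaled_Suc_high[OF x(2) this]]
      show "almost_Cauchy (\<lambda>k. scaled (Suc k) x) c" .
    qed
    show "?Q 1 c" if "c > 0" for c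
      unfolding almost_Cauchy_def
    proof (intro allI impI)
      fix e assume "c < e"
      then have "e > 0" using that by simp
      then show "\<exists>K. \<forall>k\<ge>K. \<forall>l\<ge>K. \<bar>scaled k 1 - scaled l 1\<bar> < e"
        using LIMSEQ_imp_Cauchy[OF scaled_one_tendsto] unfolding Cauchy_def dist_real_def by blast
    qed
    show "?Q x 2" if "x \<in> {0<..1}" for x
      unfolding almost_Cauchy_def
    proof (intro allI impI exI[of _ 0])
      fix e :: real and k l :: nat assume "2 < e"
      then show "\<bar>scaled k x - scaled l x\<bar> < e"
        using that scaled_bounds[of x k] scaled_bounds[of x l] by auto
    qed
  qed auto
  then have Q: "\<exists>K. \<forall>k\<ge>K. \<forall>l\<ge>K. \<bar>scaled k x - scaled l x\<bar> < e" if "e > 2 * (1 / 4) ^ n" for n e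
    using that unfolding almost_Cauchy_def by (simp add: power_one_over)
  have "Cauchy (\<lambda>k. scaled k x)"
    unfolding Cauchy_def dist_real_def
  proof (intro allI impI)
    fix e :: real assume "e > 0"
    then obtain n where "(1 / 4) ^ n < e / 2" using real_arch_pow_inv[of "e / 2" "1 / 4"] by auto
    then show "\<exists>M. \<forall>m\<ge>M. \<forall>n\<ge>M. \<bar>scaled m x - scaled n x\<bar> < e" by (intro Q[of n]) simp
  qed
  then show ?thesis by (simp add: Cauchy_convergent_iff)
qed

section \<open>Functional equations and continuity of the limit\<close>

definition profile :: "real \<Rightarrow> real" where
  "profile x = lim (\<lambda>k. scaled k x)"

lemma scaled_tendsto: "0 \<le> x \<Longrightarrow> x \<le> 1 \<Longrightarrow> (\<lambda>k. scaled k x) \<longlonglongrightarrow> profile x"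
  unfolding profile_def using scaled_convergent convergent_LIMSEQ_iff by blast

lemma profile_bounds: "0 \<le> x \<Longrightarrow> x \<le> 1 \<Longrightarrow> 0 \<le> profile x \<and> profile x \<le> 2"
  using scaled_tendsto scaled_bounds by (meson LIMSEQ_le_const LIMSEQ_le_const2)

lemma profile_low:
  assumes "0 \<le> x" "x \<le> 1 / 2"
  shows "profile x = profile (2 * x) / 4"
proof (rule LIMSEQ_unique)
  show "(\<lambda>k. scaled (Suc k) x) \<longlonglongrightarrow> profile x"
    using assms by (intro LIMSEQ_Suc scaled_tendsto) auto
  show "(\<lambda>k. scaled (Suc k) x) \<longlonglongrightarrow> profile (2 * x) / 4"
    unfolding scaled_Suc_low using assms by (intro tendsto_intros scaled_tendsto) auto
qed

lemma profile_high:
  assumes "1 / 2 < x" "x \<le> 1"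
  shows "profile x = profile (2 * x - 1) + 2 * (1 - x)\<^sup>2"
proof (rule LIMSEQ_unique)
  show "(\<lambda>k. scaled (Suc k) x) \<longlonglongrightarrow> profile x"
    using assms by (intro LIMSEQ_Suc scaled_tendsto) auto
  have "(\<lambda>k. scaled k (2 * x - 1) + correction k (2 * x - 1)) \<longlonglongrightarrow> profile (2 * x - 1) + 2 * (1 - x)\<^sup>2"
    using assms by (intro tendsto_add scaled_tendsto correction_tendsto) auto
  then show "(\<lambda>k. scaled (Suc k) x) \<longlonglongrightarrow> profile (2 * x - 1) + 2 * (1 - x)\<^sup>2"
    by (rule Lim_transform_eventually) (use scaled_Suc_high[OF assms] in eventually_elim, simp)
qed

text \<open>A local deviation bound playing the role of \<open>almost_Cauchy\<close>. Here
  \<open>y\<close> ranges over all reals, so neighborhoods must be chosen inside the region where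
  the functional equations hold.\<close>

definition almost_continuous :: "real \<Rightarrow> real \<Rightarrow> bool" where
  "almost_continuous x c \<longleftrightarrow> (\<forall>e>c. \<exists>d>0. \<forall>y. \<bar>y - x\<bar> < d \<longrightarrow> \<bar>profile y - profile x\<bar> < e)"

text \<open>Non-dyadic points stay non-dyadic under both digit maps and never equal 1/2, so all
  nearby \<open>y\<close> obey the same functional equation as \<open>x\<close>. The contraction
  then reduces the deviation to 0.\<close>

lemma profile_continuous:
  assumes "x \<in> {0..1} - dyadics"
  shows "isCont profile x"
proof -
  have "almost_continuous x (2 / 4 ^ n)" for n
  proof (rule binary_contraction[of "{0..1} - dyadics"])
    show "{0..1} - dyadics \<subseteq> {0<..1}" using dyadics_simps by (auto simp: less_le)
    show "almost_continuous x (c / 4)" if x: "x \<in> {0..1} - dyadics" "x \<le> 1 / 2" and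
      Q: "almost_continuous (2 * x) c" for x c
      unfolding almost_continuous_def
    proof (intro allI impI)
      fix e assume "c / 4 < e"
      then have "4 * e > c" by simp
      then obtain d where d: "d > 0" "\<And>y. \<bar>y - 2 * x\<bar> < d \<Longrightarrow> \<bar>profile y - profile (2 * x)\<bar> < 4 * e"
        using Q unfolding almost_continuous_def by blast
      have "x \<noteq> 0" "x \<noteq> 1 / 2" using x(1) dyadics_simps by blast+
      then have x': "0 < x" "x < 1 / 2" using x by auto
      have "\<bar>profile y - profile x\<bar> < e" if "\<bar>y - x\<bar> < min (d / 2) (min x (1 / 2 - x))" for y
      proof -
        have "\<bar>y - x\<bar> < d / 2" "\<bar>y - x\<bar> < x" "\<bar>y - x\<bar> < 1 / 2 - x" using that by simp_all
        then have "0 \<le> y" "y \<le> 1 / 2" "\<bar>2 * y - 2 * x\<bar> < d" by linarith+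
        then show ?thesis using d(2)[of "2 * y"] x' profile_low[of x] profile_low[of y] by auto
      qed
      then show "\<exists>d>0. \<forall>y. \<bar>y - x\<bar> < d \<longrightarrow> \<bar>profile y - profile x\<bar> < e"
        using d(1) x' by (intro exI[of _ "min (d / 2) (min x (1 / 2 - x))"]) auto
    qed
    show "almost_continuous x c" if x: "x \<in> {0..1} - dyadics" "1 / 2 < x" "x < 1" and
      Q: "almost_continuous (2 * x - 1) c" for x c
      unfolding almost_continuous_def
    proof (intro allI impI)
      fix e assume "c < e"
      then have "(c + e) / 2 > c" and e': "(e - c) / 2 > 0" by simp_all
      then obtain d where d: "d > 0"
        "\<And>y. \<bar>y - (2 * x - 1)\<bar> < d \<Longrightarrow> \<bar>profile y - profile (2 * x - 1)\<bar> < (c + e) / 2"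
        using Q unfolding almost_continuous_def by blast
      have "isCont (\<lambda>y. 2 * (1 - y)\<^sup>2) x" by (intro continuous_intros)
      then obtain d' where d': "d' > 0" 
        "\<And>y. \<bar>y - x\<bar> < d' \<Longrightarrow> \<bar>2 * (1 - y)\<^sup>2 - 2 * (1 - x)\<^sup>2\<bar> < (e - c) / 2"
        using e' unfolding continuous_at_eps_delta dist_real_def by metis
      \<comment> \<open>The last two terms keep \<open>y\<close> in the upper half of the
        interval.\<close>
      let ?d = "min (min (d / 2) d') (min (x - 1 / 2) (1 - x))"
      have "\<bar>profile y - profile x\<bar> < e" if "\<bar>y - x\<bar> < ?d" for y
      proof -
        have y: "\<bar>y - x\<bar> < d / 2" "\<bar>y - x\<bar> < d'" "\<bar>y - x\<bar> < x - 1 / 2" "\<bar>y - x\<bar> < 1 - x"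
          using that by simp_all
        then have y': "1 / 2 < y" "y \<le> 1" "\<bar>(2 * y - 1) - (2 * x - 1)\<bar> < d" by linarith+
        have "profile y - profile x = (profile (2 * y - 1) - profile (2 * x - 1))
            + (2 * (1 - y)\<^sup>2 - 2 * (1 - x)\<^sup>2)"
          using profile_high[OF y'(1,2)] profile_high[of x] x by simp
        then have "\<bar>profile y - profile x\<bar> \<le> \<bar>profile (2 * y - 1) - profile (2 * x - 1)\<bar>
            + \<bar>2 * (1 - y)\<^sup>2 - 2 * (1 - x)\<^sup>2\<bar>"
          by (simp only: abs_triangle_ineq)
        also have "\<dots> < (c + e) / 2 + (e - c) / 2"
          by (rule add_strict_mono[OF d(2)[OF y'(3)] d'(2)[OF y(2)]])
        finally show ?thesis by (simp add: field_simps)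
      qed
      then show "\<exists>d>0. \<forall>y. \<bar>y - x\<bar> < d \<longrightarrow> \<bar>profile y - profile x\<bar> < e"
        using d(1) d'(1) x by (intro exI[of _ ?d]) auto
    qed
    show "almost_continuous x 2" if x: "x \<in> {0..1} - dyadics" for x
      unfolding almost_continuous_def
    proof (intro allI impI)
      fix e :: real assume e: "2 < e"
      have "x \<noteq> 0" "x \<noteq> 1" using x dyadics_simps by blast+
      then have x': "0 < x" "x < 1" using x by auto
      have "\<bar>profile y - profile x\<bar> < e" if "\<bar>y - x\<bar> < min x (1 - x)" for y
        using that x' e profile_bounds[of x] profile_bounds[of y] by (simp add: abs_if split: if_splits)
      then show "\<exists>d>0. \<forall>y. \<bar>y - x\<bar> < d \<longrightarrow> \<bar>profile y - profile x\<bar> < e"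
        using x' by (intro exI[of _ "min x (1 - x)"]) auto
    qed
    show "2 * x \<in> {0..1} - dyadics" if "x \<in> {0..1} - dyadics" "x \<le> 1 / 2" for x
      using that dyadics_half[of x] by auto
    show "2 * x - 1 \<in> {0..1} - dyadics" if "x \<in> {0..1} - dyadics" "1 / 2 < x" for x
      using that dyadics_half[of x] dyadics_diff_one[of "2 * x"] by auto
    show "almost_continuous 1 c" if "1 \<in> {0..1} - dyadics" for c
      using that dyadics_simps by blast
  qed (use assms in auto)
  then have Q: "\<exists>d>0. \<forall>y. \<bar>y - x\<bar> < d \<longrightarrow> \<bar>profile y - profile x\<bar> < e" if "e > 2 * (1 / 4) ^ n" for n e
    using that unfolding almost_continuous_def by (simp add: power_one_over)
  show ?thesis
    unfolding continuous_at_eps_delta dist_real_def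
  proof (intro allI impI)
    fix e :: real assume "e > 0"
    then obtain n where "(1 / 4) ^ n < e / 2" using real_arch_pow_inv[of "e / 2" "1 / 4"] by auto
    then show "\<exists>d>0. \<forall>y. \<bar>y - x\<bar> < d \<longrightarrow> \<bar>profile y - profile x\<bar> < e" by (intro Q[of n]) simp
  qed
qed

text \<open>Truncation to \<open>k\<close> digits does not change the integer part of
  \<open>2 ^ k * x\<close>, and the denominator divided by \<open>4 ^ k\<close> is
  \<open>scaled k 1\<close>.\<close>

lemma G_lim_eq_profile:
  assumes "0 \<le> x" "x \<le> 1"
  shows "G_lim f x = 3 / 4 * profile x"
proof -
  have "G_approx f k (bin_trunc x k) = scaled k x / scaled k 1" for k
  proof -
    have "\<lfloor>(2::real) ^ k\<rfloor> = 2 ^ k" using floor_of_int[of "2 ^ k"] by simp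
    then show ?thesis
      by (simp add: G_approx_def bin_trunc_eq_floor[OF assms] scaled_def nat_power_eq)
  qed
  moreover have "(\<lambda>k. scaled k x / scaled k 1) \<longlonglongrightarrow> profile x / (4 / 3)"
    by (intro tendsto_divide scaled_tendsto scaled_one_tendsto assms) simp
  ultimately show ?thesis unfolding G_lim_def by (simp add: limI)
qed

text \<open>The functional equations give \<open>I = I / 8 + (I / 2 + 1 / 12)\<close>: the lower
  half has a factor 1/4 from the values and 1/2 from the substitution, the upper half only the
  latter.\<close>

lemma profile_has_integral: 
  assumes I: "(profile has_integral I) {0..1}"
  shows "I = 2 / 9"
proof -
  have "((\<lambda>x. profile (2 * x) / 4) has_integral I / 8) {0..1 / 2}"
    using has_integral_divide[OF has_integral_affinity[of profile I 0 1 2 0], of 4] I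
    by (simp add: image_mult_atLeastAtMost_if)
  then have low: "(profile has_integral I / 8) {0..1 / 2}"
    by (rule has_integral_eq[rotated]) (simp add: profile_low)
  have "((\<lambda>x. profile (2 * x - 1)) has_integral I / 2) {1 / 2..1}"
    using has_integral_affinity[of profile I 0 1 2 "-1"] I
    by (simp add: image_affinity_atLeastAtMost_div)
  moreover have "((\<lambda>x::real. 2 * (1 - x)\<^sup>2) has_integral (- (2 / 3) * (1 - 1) ^ 3 - - (2 / 3) * (1 - 1 / 2) ^ 3)) {1 / 2..1}"
    by (rule fundamental_theorem_of_calculus)
      (auto intro!: derivative_eq_intros simp: has_real_derivative_iff_has_vector_derivative[symmetric])
  ultimately have "((\<lambda>x. profile (2 * x - 1) + 2 * (1 - x)\<^sup>2) has_integral (I / 2 + 1 / 12)) {1 / 2..1}"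
    by (auto dest: has_integral_add simp: power3_eq_cube)
  \<comment> \<open>\<open>profile_high\<close> does not cover the end point 1/2, which is discarded
    as a finite set.\<close>
  then have "(profile has_integral (I / 2 + 1 / 12)) {1 / 2..1}"
    by (rule has_integral_spike_finite[of "{1 / 2}", rotated 2]) (auto simp: profile_high)
  from has_integral_combine[OF _ _ low this] have "(profile has_integral (I / 8 + (I / 2 + 1 / 12))) {0..1}"
    by simp
  then show ?thesis using has_integral_unique[OF I, of "I / 8 + (I / 2 + 1 / 12)"] by simp
qed

lemma G_lim_has_riemann_integral: "has_riemann_integral (G_lim f) (integral {0..1} (G_lim f)) 0 1"
proof (rule has_riemann_integral_countable_discontinuities[OF _ countable_dyadics])
  show "\<bar>G_lim f x\<bar> \<le> 3 / 2" if "x \<in> {0..1}" for x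
    using that profile_bounds[of x] by (simp add: G_lim_eq_profile)
  show "continuous (at x within {0..1}) (G_lim f)" if x: "x \<in> {0..1} - dyadics" for x
  \<comment> \<open>The two functions are known to agree on the unit interval only, hence continuity
    within it.\<close>
  proof (rule continuous_transform_within[of x "{0..1}" "\<lambda>x. 3 / 4 * profile x" 1])
    show "continuous (at x within {0..1}) (\<lambda>x. 3 / 4 * profile x)"
      by (rule continuous_mult_left[OF continuous_at_imp_continuous_at_within[OF profile_continuous[OF x]]])
  qed (use x in \<open>auto simp: G_lim_eq_profile\<close>)
qed

lemma integral_G_lim: "integral {0..1} (G_lim f) = 1 / 6"
proof -
  have "((\<lambda>x. 4 / 3 * G_lim f x) has_integral (4 / 3 * integral {0..1} (G_lim f))) {0..1}"
    by (intro has_integral_mult_right has_riemann_integral_imp_has_integral G_lim_has_riemann_integral)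
  then have "(profile has_integral (4 / 3 * integral {0..1} (G_lim f))) {0..1}"
    by (rule has_integral_eq[rotated]) (simp add: G_lim_eq_profile)
  then show ?thesis using profile_has_integral[of "4 / 3 * integral {0..1} (G_lim f)"] by simp
qed

end

theorem theorem4:
  fixes f :: local_rule
  assumes "Tb_rule f"
  shows "riemann_integrable (G_lim f) 0 1 \<and> integral {0..1} (G_lim f) = 1 / 6"
  using G_lim_has_riemann_integral[OF assms] integral_G_lim[OF assms]
  unfolding riemann_integrable_def by blast

end
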